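(* Let $(\beta,\gamma)$ be the Kauffman bracket switchback pair on $V$ over $\mathcal{K}$, let $(\beta_1,\gamma_1)$ be $2$-cocycles, and let $R_t=a\,1+b\,(\gamma+t\gamma_1)(\beta+t\beta_1)$ be the cocycle deformation of the Kauffman bracket $R$-matrix $R=A\,1+A^{-1}(\gamma\beta)$, where $a,b$ are invertible and $a^2+b^2+\delta_0ab=0$ with $\delta_0=(\beta+t\beta_1)(\gamma+t\gamma_1)(1)$. Then the knot invariant $\mathrm{DB}$ defined from $R_t$ is an evaluation of the Jones polynomial by a truncated polynomial.
   Context: $V$ has basis $x,y$, and the Kauffman bracket pair is $\beta(x\otimes x)=\beta(y\otimes y)=0$, $\beta(x\otimes y)=iA$, $\beta(y\otimes x)=-iA^{-1}$, $\gamma(1)=iA(x\otimes y)-iA^{-1}(y\otimes x)$, with complex coefficients and $A$ a variable; $\mathcal{K}$ denotes the (commutative, unital) coefficient ring. It satisfies the switchback conditions $(\beta\otimes 1)(1\otimes\gamma)=1$ and $(1\otimes\beta)(\gamma\otimes 1)=1$, where $1$ denotes identity maps. $2$-cocycles are $\beta_1\in\mathrm{Hom}(V^{\otimes 2},\mathcal{K})$, $\gamma_1\in\mathrm{Hom}(\mathcal{K},V^{\otimes 2})$ with $(\beta\otimes 1)(1\otimes\gamma_1)+(\beta_1\otimes 1)(1\otimes\gamma)=0$ and $(1\otimes\beta)(\gamma_1\otimes 1)+(1\otimes\beta_1)(\gamma\otimes 1)=0$. Then $\tilde\beta=\beta+t\beta_1$, $\tilde\gamma=\gamma+t\gamma_1$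 form a switchback pair over the truncated polynomial ring $\mathcal{K}[t]/(t^2)$, in which $a,b,\delta_0$ lie, and $R_t$ is an invertible solution of the Yang–Baxter equation with $R_t^{-1}=a'1+b'(\tilde\gamma\tilde\beta)$, $a'=a^{-1}$, $b'=b^{-1}$. Definition of $\mathrm{DB}$ (Turaev's construction): let $\tau$ be the transposition $v\otimes w\mapsto w\otimes v$, let $\nu_t=(1\otimes\tilde\beta)(\tau\otimes 1)(1\otimes\tilde\gamma)$, and let $u,v$ be invertible with $uv=\delta_0a+b$ and $u^{-1}v=\delta_0a'+b'$. For the closure $\hat w$ of an $n$-braid word $w$, $\mathrm{DB}(\hat w)=u^{-\mathcal{W}(w)}v^{-n}\,\mathrm{Tr}(\nu_t^{\otimes n}\circ R_t(w))$, where $\mathcal{W}(w)$ is the writhe, $\mathrm{Tr}$ is the trace, and $R_t(w)$ is the image of $w$ under the braid group representation induced from $R_t$. Sense of the conclusion: $\mathrm{DB}$ satisfies $(b'u)\,\mathrm{DB}(K_+)-(bu^{-1})\,\mathrm{DB}(K_-)=(ab'-a'b)\,\mathrm{DB}(K_0)$, where $K_+,K_-,K_0$ differ at one crossing (positive, negative, smoothed). With $c=a/b$ and $\ell=b^{-1}u$ this reads $\ell\,\mathrm{DB}(K_+)-\ell^{-1}\mathrm{DB}(K_-)=(c-c^{-1})\,\mathrm{DB}(K_0)$ with $\ell=\pm c^2$, which is the skein relation of the Jones polynomial up to sign, with coefficients in $\mathcal{K}[t]/(t^2)$. *)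

theory Defs
  imports
    "Jordan_Normal_Form.Matrix"
    "HOL-Computational_Algebra.Polynomial"
    "HOL-Library.Poly_Mapping"
begin

section \<open>Units of a commutative ring\<close>

text \<open>Only meaningful when \<^term>\<open>x dvd 1\<close>, i.e. when \<open>x\<close> is invertible.\<close>

definition ring_inv :: "'a::comm_ring_1 \<Rightarrow> 'a" where
  "ring_inv x = (THE y. x * y = 1)"

definition unit_power :: "'a::comm_ring_1 \<Rightarrow> int \<Rightarrow> 'a" where
  "unit_power x k = (if 0 \<le> k then x ^ nat k else ring_inv x ^ nat (- k))"


section \<open>The truncated polynomial ring $K[t]/(t^2)$\<close>

definition trunc_rel :: "'a::comm_ring_1 poly \<Rightarrow> 'a poly \<Rightarrow> bool" where
  "trunc_rel p q \<longleftrightarrow> monom 1 2 dvd (p - q)"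

lemma equivp_trunc_rel: "equivp (trunc_rel :: 'a::comm_ring_1 poly \<Rightarrow> _)"
proof (rule equivpI)
  show "reflp (trunc_rel :: 'a poly \<Rightarrow> _)" by (rule reflpI) (simp add: trunc_rel_def)
  show "symp (trunc_rel :: 'a poly \<Rightarrow> _)"
    by (rule sympI) (metis trunc_rel_def dvd_minus_iff minus_diff_eq)
  show "transp (trunc_rel :: 'a poly \<Rightarrow> _)"
  proof (rule transpI)
    fix p q r :: "'a poly"
    assume "trunc_rel p q" "trunc_rel q r"
    then have "monom 1 2 dvd (p - q) + (q - r)"
      unfolding trunc_rel_def by (rule dvd_add)
    then show "trunc_rel p r" by (simp add: trunc_rel_def)
  qed
qed

quotient_type (overloaded) 'a trunc = "'a::comm_ring_1 poly" / trunc_rel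
  by (rule equivp_trunc_rel)

instantiation trunc :: (comm_ring_1) comm_ring_1
begin

lift_definition zero_trunc :: "'a trunc" is 0 .

lift_definition one_trunc :: "'a trunc" is 1 .

lift_definition plus_trunc :: "'a trunc \<Rightarrow> 'a trunc \<Rightarrow> 'a trunc" is "(+)"
  unfolding trunc_rel_def by (metis add_diff_add dvd_add)

lift_definition minus_trunc :: "'a trunc \<Rightarrow> 'a trunc \<Rightarrow> 'a trunc" is "(-)"
proof -
  fix p p' q q' :: "'a poly"
  assume "trunc_rel p p'" "trunc_rel q q'"
  then have "monom 1 2 dvd (p - p') - (q - q')"
    unfolding trunc_rel_def by (rule dvd_diff)
  then show "trunc_rel (p - q) (p' - q')"
    by (simp add: trunc_rel_def algebra_simps)
qed

lift_definition uminus_trunc :: "'a trunc \<Rightarrow> 'a trunc" is uminus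
  unfolding trunc_rel_def by (metis dvd_minus_iff minus_diff_minus)

lift_definition times_trunc :: "'a trunc \<Rightarrow> 'a trunc \<Rightarrow> 'a trunc" is "(*)"
proof -
  fix p p' q q' :: "'a poly"
  assume "trunc_rel p p'" "trunc_rel q q'"
  then have "monom 1 2 dvd (p - p') * q + p' * (q - q')"
    unfolding trunc_rel_def by (intro dvd_add dvd_mult dvd_mult2)
  then show "trunc_rel (p * q) (p' * q')"
    by (simp add: trunc_rel_def algebra_simps)
qed

instance
proof
  fix a b c :: "'a trunc"
  show "a * b * c = a * (b * c)" by transfer (simp add: trunc_rel_def algebra_simps)
  show "a * b = b * a" by transfer (simp add: trunc_rel_def algebra_simps)
  show "1 * a = a" by transfer (simp add: trunc_rel_def)
  show "a + b + c = a + (b + c)" by transfer (simp add: trunc_rel_def algebra_simps)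
  show "a + b = b + a" by transfer (simp add: trunc_rel_def algebra_simps)
  show "0 + a = a" by transfer (simp add: trunc_rel_def)
  show "- a + a = 0" by transfer (simp add: trunc_rel_def)
  show "a - b = a + - b" by transfer (simp add: trunc_rel_def)
  show "(a + b) * c = a * c + b * c" by transfer (simp add: trunc_rel_def algebra_simps)
  show "(0::'a trunc) \<noteq> 1"
  proof transfer
    have "\<not> monom 1 2 dvd (- 1 :: 'a poly)"
    proof
      assume "monom 1 2 dvd (- 1 :: 'a poly)"
      then obtain q :: "'a poly" where "- 1 = monom 1 2 * q" by (rule dvdE)
      then have "coeff (- 1 :: 'a poly) 0 = coeff (monom 1 2 * q) 0" by simp
      then show False by (simp add: coeff_monom_mult)
    qed
    then show "\<not> trunc_rel 0 (1 :: 'a poly)" by (simp add: trunc_rel_def)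
  qed
qed

end

lift_definition trunc_const :: "'a::comm_ring_1 \<Rightarrow> 'a trunc" is "\<lambda>k. [:k:]" .

lift_definition trunc_var :: "'a::comm_ring_1 trunc" is "[:0, 1:]" .


section \<open>Linear maps between tensor powers of $V$\<close>

text \<open>
  \<open>V\<close> is free with ordered basis \<open>x, y\<close>. A linear map from the \<open>m\<close>-th to the \<open>n\<close>-th
  tensor power of \<open>V\<close> is its \<open>2^n\<close> by \<open>2^m\<close> matrix in the lexicographically ordered product
  bases (\<open>xx, xy, yx, yy\<close> for the square). Composition is then the matrix product, and the
  tensor product of maps is the Kronecker product.
\<close>

definition tensor_mat :: "'a::comm_ring_1 mat \<Rightarrow> 'a mat \<Rightarrow> 'a mat" (infixl "\<otimes>\<^sub>t" 71) where
  "M \<otimes>\<^sub>t N = mat (dim_row M * dim_row N) (dim_col M * dim_col N)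
     (\<lambda>(i, j). M $$ (i div dim_row N, j div dim_col N) * N $$ (i mod dim_row N, j mod dim_col N))"

primrec tensor_pow :: "'a::comm_ring_1 mat \<Rightarrow> nat \<Rightarrow> 'a mat" where
  "tensor_pow M 0 = 1\<^sub>m 1"
| "tensor_pow M (Suc n) = M \<otimes>\<^sub>t tensor_pow M n"

definition mat_tr :: "'a::comm_ring_1 mat \<Rightarrow> 'a" where
  "mat_tr M = (\<Sum>i<dim_row M. M $$ (i, i))"

definition mat_inv :: "'a::comm_ring_1 mat \<Rightarrow> 'a mat" where
  "mat_inv M = (THE N. N \<in> carrier_mat (dim_col M) (dim_row M) \<and> inverts_mat M N \<and> inverts_mat N M)"

definition transposition :: "'a::comm_ring_1 mat" where
  "transposition = mat_of_rows_list 4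
     [[1, 0, 0, 0],
      [0, 0, 1, 0],
      [0, 1, 0, 0],
      [0, 0, 0, 1]]"


section \<open>The Kauffman bracket pair and its deformations\<close>

text \<open>The arguments stand for the imaginary unit, the variable \<open>A\<close>, and its inverse, in \<open>K\<close>.\<close>

definition kauffman_\<beta> :: "'a::comm_ring_1 \<Rightarrow> 'a \<Rightarrow> 'a \<Rightarrow> 'a mat" where
  "kauffman_\<beta> im A A' = mat_of_rows_list 4 [[0, im * A, - (im * A'), 0]]"

definition kauffman_\<gamma> :: "'a::comm_ring_1 \<Rightarrow> 'a \<Rightarrow> 'a \<Rightarrow> 'a mat" where
  "kauffman_\<gamma> im A A' = mat_of_rows_list 1 [[0], [im * A], [- (im * A')], [0]]"

definition switchback_2cocycle ::
    "'a::comm_ring_1 mat \<Rightarrow> 'a mat \<Rightarrow> 'a mat \<Rightarrow> 'a mat \<Rightarrow> bool" where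
  "switchback_2cocycle \<beta> \<gamma> \<beta>1 \<gamma>1 \<longleftrightarrow>
     \<beta>1 \<in> carrier_mat 1 4 \<and> \<gamma>1 \<in> carrier_mat 4 1 \<and>
     (\<beta> \<otimes>\<^sub>t 1\<^sub>m 2) * (1\<^sub>m 2 \<otimes>\<^sub>t \<gamma>1) + (\<beta>1 \<otimes>\<^sub>t 1\<^sub>m 2) * (1\<^sub>m 2 \<otimes>\<^sub>t \<gamma>) = 0\<^sub>m 2 2 \<and>
     (1\<^sub>m 2 \<otimes>\<^sub>t \<beta>) * (\<gamma>1 \<otimes>\<^sub>t 1\<^sub>m 2) + (1\<^sub>m 2 \<otimes>\<^sub>t \<beta>1) * (\<gamma> \<otimes>\<^sub>t 1\<^sub>m 2) = 0\<^sub>m 2 2"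

definition deform :: "'a::comm_ring_1 mat \<Rightarrow> 'a mat \<Rightarrow> 'a trunc mat" where
  "deform M M1 = map_mat trunc_const M + trunc_var \<cdot>\<^sub>m map_mat trunc_const M1"

definition R_mat :: "'a::comm_ring_1 \<Rightarrow> 'a \<Rightarrow> 'a mat \<Rightarrow> 'a mat \<Rightarrow> 'a mat" where
  "R_mat a b \<beta> \<gamma> = a \<cdot>\<^sub>m 1\<^sub>m 4 + b \<cdot>\<^sub>m (\<gamma> * \<beta>)"

definition loop_value :: "'a::comm_ring_1 mat \<Rightarrow> 'a mat \<Rightarrow> 'a" where
  "loop_value \<beta> \<gamma> = (\<beta> * \<gamma>) $$ (0, 0)"

definition nu_mat :: "'a::comm_ring_1 mat \<Rightarrow> 'a mat \<Rightarrow> 'a mat" where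
  "nu_mat \<beta> \<gamma> = (1\<^sub>m 2 \<otimes>\<^sub>t \<beta>) * (transposition \<otimes>\<^sub>t 1\<^sub>m 2) * (1\<^sub>m 2 \<otimes>\<^sub>t \<gamma>)"


section \<open>Braid words and oriented links as closed braids\<close>

text \<open>
  \<open>Pos i\<close> and \<open>Neg i\<close> are the positive and negative crossing of the strands \<open>i\<close> and
  \<open>i + 1\<close>, counting strands from \<open>0\<close>.
\<close>

datatype crossing = Pos (strand: nat) | Neg (strand: nat)

definition braid_word :: "nat \<Rightarrow> crossing list \<Rightarrow> bool" where
  "braid_word n w \<longleftrightarrow> 1 \<le> n \<and> (\<forall>c\<in>set w. Suc (strand c) < n)"

definition writhe :: "crossing list \<Rightarrow> int" where
  "writhe w = sum_list (map (case_crossing (\<lambda>_. 1) (\<lambda>_. - 1)) w)"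

text \<open>
  By the theorems of Alexander and Markov, oriented links up to isotopy are the classes of
  braid words under the following relation: the defining relations of the braid groups
  (relations between inverse generators follow from these), conjugation, in the form of
  cyclic permutation of words, and stabilisation.
\<close>

inductive same_closure :: "nat \<Rightarrow> crossing list \<Rightarrow> nat \<Rightarrow> crossing list \<Rightarrow> bool" where
  refl: "braid_word n w \<Longrightarrow> same_closure n w n w"
| sym: "same_closure m w n w' \<Longrightarrow> same_closure n w' m w"
| trans: "same_closure l w m w' \<Longrightarrow> same_closure m w' n w'' \<Longrightarrow> same_closure l w n w''"
| cancel_Pos: "braid_word n (p @ [Pos i, Neg i] @ q) \<Longrightarrow>
    same_closure n (p @ [Pos i, Neg i] @ q) n (p @ q)"
| cancel_Neg: "braid_word n (p @ [Neg i, Pos i] @ q) \<Longrightarrow>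
    same_closure n (p @ [Neg i, Pos i] @ q) n (p @ q)"
| far: "Suc i < j \<Longrightarrow> braid_word n (p @ [Pos i, Pos j] @ q) \<Longrightarrow>
    same_closure n (p @ [Pos i, Pos j] @ q) n (p @ [Pos j, Pos i] @ q)"
| braid: "braid_word n (p @ [Pos i, Pos (Suc i), Pos i] @ q) \<Longrightarrow>
    same_closure n (p @ [Pos i, Pos (Suc i), Pos i] @ q)
      n (p @ [Pos (Suc i), Pos i, Pos (Suc i)] @ q)"
| cyclic: "braid_word n (p @ q) \<Longrightarrow> same_closure n (p @ q) n (q @ p)"
| stabilise_Pos: "braid_word n w \<Longrightarrow> same_closure n w (Suc n) (w @ [Pos (n - 1)])"
| stabilise_Neg: "braid_word n w \<Longrightarrow> same_closure n w (Suc n) (w @ [Neg (n - 1)])"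

definition link_invariant :: "(nat \<Rightarrow> crossing list \<Rightarrow> 'b) \<Rightarrow> bool" where
  "link_invariant f \<longleftrightarrow> (\<forall>m w n w'. same_closure m w n w' \<longrightarrow> f m w = f n w')"

text \<open>
  \<open>l F(K_+) - l' F(K_-) = z F(K_0)\<close> for links differing at one crossing: every such triple is,
  up to isotopy, a triple of closed braids differing in one letter of the word.
\<close>

definition skein_relation ::
    "'a::comm_ring_1 \<Rightarrow> 'a \<Rightarrow> 'a \<Rightarrow> (nat \<Rightarrow> crossing list \<Rightarrow> 'a) \<Rightarrow> bool" where
  "skein_relation l l' z F \<longleftrightarrow> (\<forall>n p q i. braid_word n (p @ [Pos i] @ q) \<longrightarrow>
     l * F n (p @ [Pos i] @ q) - l' * F n (p @ [Neg i] @ q) = z * F n (p @ q))"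


section \<open>The invariant DB\<close>

definition crossing_mat :: "'a::comm_ring_1 mat \<Rightarrow> nat \<Rightarrow> crossing \<Rightarrow> 'a mat" where
  "crossing_mat R n c =
     1\<^sub>m (2 ^ strand c) \<otimes>\<^sub>t (case c of Pos _ \<Rightarrow> R | Neg _ \<Rightarrow> mat_inv R)
       \<otimes>\<^sub>t 1\<^sub>m (2 ^ (n - 2 - strand c))"

definition braid_rep :: "'a::comm_ring_1 mat \<Rightarrow> nat \<Rightarrow> crossing list \<Rightarrow> 'a mat" where
  "braid_rep R n w = foldr (\<lambda>c M. crossing_mat R n c * M) w (1\<^sub>m (2 ^ n))"

definition DB :: "'a::comm_ring_1 mat \<Rightarrow> 'a mat \<Rightarrow> 'a \<Rightarrow> 'a \<Rightarrow> nat \<Rightarrow> crossing list \<Rightarrow> 'a" where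
  "DB R \<nu> u v n w =
     unit_power u (- writhe w) * unit_power v (- int n) * mat_tr (tensor_pow \<nu> n * braid_rep R n w)"


section \<open>The Jones polynomial\<close>

text \<open>
  Integer Laurent polynomials in a variable \<open>s\<close>, the square root of the usual variable of the
  Jones polynomial.
\<close>

type_synonym laurent = "int \<Rightarrow>\<^sub>0 int"

abbreviation s_pow :: "int \<Rightarrow> laurent" where
  "s_pow k \<equiv> Poly_Mapping.single k 1"

definition laurent_eval :: "'a::comm_ring_1 \<Rightarrow> laurent \<Rightarrow> 'a" where
  "laurent_eval s f = (\<Sum>k\<in>Poly_Mapping.keys f. of_int (Poly_Mapping.lookup f k) * unit_power s k)"

text \<open>
  The Jones polynomial is the unique link invariant equal to \<open>1\<close> on the unknot and satisfying
  \<open>s^(-2) J(K_+) - s^2 J(K_-) = (s - s^(-1)) J(K_0)\<close>.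
\<close>

definition is_jones_polynomial :: "(nat \<Rightarrow> crossing list \<Rightarrow> laurent) \<Rightarrow> bool" where
  "is_jones_polynomial J \<longleftrightarrow>
     link_invariant J \<and> J 1 [] = 1 \<and>
     skein_relation (s_pow (- 2)) (s_pow 2) (s_pow 1 - s_pow (- 1)) J"

end

theory Submission
  imports Defs
begin

text \<open>
  A switchback pair over any commutative ring gives a Temperley-Lieb element \<open>U = \<gamma>\<beta>\<close>, and
  \<open>\<nu>\<close> fixes \<open>U\<close> on both sides after tensoring, so Turaev's conditions for \<open>R = a + bU\<close> reduce to
  the scalar relation on \<open>a\<close>, \<open>b\<close>, \<open>\<delta>\<close>. The cocycle conditions say exactly that the deformed pair is
  again a switchback pair over the truncated polynomials. Comparing the two equations for \<open>u\<close> and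
  \<open>v\<close> gives \<open>u\<^sup>2 b\<^sup>2 = a\<^sup>4\<close>, hence the sign \<open>\<epsilon> = u b / a\<^sup>2\<close>. The identification with the Jones
  polynomial is uniqueness of skein invariants: modulo the skein relation every braid word is a
  combination of words containing the last generator at most once, and the Markov moves then remove
  a strand.
\<close>

section \<open>Functionals on positive words with a quadratic relation\<close>

text \<open>The obstacle that shapes the proof is zero divisors. \<open>K\<close> is any commutative
  ring receiving the complex numbers, the truncated ring has \<open>t^2 = 0\<close>, and
  \<open>c - ring_inv c\<close> may vanish or divide zero. So the skein relation cannot be divided
  by its right-hand coefficient, and a square root of one need not be a sign. In the target ring
  only units are inverted: \<open>a\<close>, \<open>b\<close>, \<open>u\<close>, \<open>v\<close>
  and the coefficients at the two crossings. The effect of a split unknot, which the skein relation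
  alone would not determine there, is read off a trace for \<open>DB\<close>; for the Jones
  polynomial it is found among integer Laurent polynomials, a domain, before evaluation. Likewise
  \<epsilon> is carried along with only \<open>\<epsilon>^2 = 1\<close>, and becomes a sign when
  \<open>K\<close> is a domain, although its truncated polynomial ring never is one.\<close>

definition hecke_functional :: "nat \<Rightarrow> 'a::comm_ring_1 \<Rightarrow> 'a \<Rightarrow> (nat list \<Rightarrow> 'a) \<Rightarrow> bool" where
  "hecke_functional N \<alpha> \<beta> g \<longleftrightarrow>
     (\<forall>p q i j. Suc i < j \<longrightarrow> g (p @ [i, j] @ q) = g (p @ [j, i] @ q)) \<and>
     (\<forall>p q i. g (p @ [i, Suc i, i] @ q) = g (p @ [Suc i, i, Suc i] @ q)) \<and>
     (\<forall>p q i. i < N \<longrightarrow> g (p @ [i, i] @ q) = \<alpha> * g (p @ [i] @ q) + \<beta> * g (p @ q))"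

text \<open>Fixed words on both sides play the part of left and right multiplication: a statement
  about functionals can then be applied to the middle segment of a longer word.\<close>

lemma hecke_functional_context:
  assumes "hecke_functional N \<alpha> \<beta> g"
  shows "hecke_functional N \<alpha> \<beta> (\<lambda>w. g (r @ w @ s))"
proof -
  have "g (r @ (p @ [i, j] @ q) @ s) = g (r @ (p @ [j, i] @ q) @ s)" if "Suc i < j" for p q i j
    using assms that unfolding hecke_functional_def
    by (metis append.assoc)
  moreover have "g (r @ (p @ [i, Suc i, i] @ q) @ s) = g (r @ (p @ [Suc i, i, Suc i] @ q) @ s)" for p q i
    using assms unfolding hecke_functional_def
    by (metis append.assoc)
  moreover have "g (r @ (p @ [i, i] @ q) @ s) = \<alpha> * g (r @ (p @ [i] @ q) @ s) + \<beta> * g (r @ (p @ q) @ s)" if "i < N" for p q i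
    using assms that unfolding hecke_functional_def
    by (metis append.assoc)
  ultimately show ?thesis unfolding hecke_functional_def by blast
qed

lemma hecke_functional_commute:
  assumes "hecke_functional N \<alpha> \<beta> g" "\<forall>i\<in>set x. Suc i < m"
  shows "g (p @ [m] @ x @ q) = g (p @ x @ [m] @ q)"
  using assms(2)
proof (induction x arbitrary: p)
  case (Cons i x)
  have "g (p @ [m] @ (i # x) @ q) = g (p @ [m, i] @ (x @ q))" by simp
  also have "\<dots> = g (p @ [i, m] @ (x @ q))"
    using assms(1) Cons.prems unfolding hecke_functional_def by (metis list.set_intros(1))
  also have "\<dots> = g ((p @ [i]) @ [m] @ x @ q)" by simp
  also have "\<dots> = g ((p @ [i]) @ x @ [m] @ q)" using Cons by (metis list.set_intros(2))
  finally show ?case by simp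
qed simp

lemma split_two_occurrences:
  assumes "2 \<le> count_list w m"
  obtains p x q where "w = p @ [m] @ x @ [m] @ q" "m \<notin> set x"
proof -
  from assms have "m \<in> set w" by (metis count_list_0_iff not_numeral_le_zero)
  then obtain p r where w: "w = p @ m # r" "m \<notin> set p" by (meson split_list_first)
  then have "count_list p m = 0" by (simp add: count_list_0_iff)
  with w assms have "count_list r m \<noteq> 0" by auto
  then have "m \<in> set r" by (simp add: count_list_0_iff)
  then obtain x q where "r = x @ m # q" "m \<notin> set x" by (meson split_list_first)
  with w that show thesis by simp
qed

text \<open>
  This is the decomposition \<open>H = H' + H' T H'\<close> of a Hecke algebra over the one with the last
  generator \<open>T\<close> removed, phrased for functionals so that no algebra has to be constructed.
\<close>

lemma hecke_functional_vanishes: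
  assumes "hecke_functional N \<alpha> \<beta> g"
    and "\<And>w. set w \<subseteq> {..<m} \<Longrightarrow> g w = 0"
    and "\<And>x y. set x \<subseteq> {..<m} \<Longrightarrow> set y \<subseteq> {..<m} \<Longrightarrow> g (x @ [m] @ y) = 0"
    and "set w \<subseteq> {..<Suc m}" "m < N"
  shows "g w = 0"
  using assms
proof (induction m arbitrary: g w)
  case 0
  have quad: "\<And>p q. g (p @ [0, 0] @ q) = \<alpha> * g (p @ [0] @ q) + \<beta> * g (p @ q)"
    using 0(1,5) unfolding hecke_functional_def by blast
  \<comment> \<open>With a single generator the quadratic relation shortens every word of length at
    least two.\<close>
  show ?case using 0(4)
  proof (induction w rule: length_induct)
    case (1 w)
    consider "w = []" | "w = [0]" | w' where "w = 0 # 0 # w'"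
    proof (cases w)
      case (Cons a l)
      then show ?thesis using 1(2) that by (cases l) auto
    qed (use that in auto)
    then show ?case
    proof cases
      case 3
      have "g (0 # w') = 0" "g w' = 0" using 1 3 by auto
      then show ?thesis using quad[of "[]" w'] 3 by simp
    qed (use 0(2)[of "[]"] 0(3)[of "[]" "[]"] in auto)
  qed
next
  case (Suc k)
  note H = Suc.prems(1) and small = Suc.prems(2) and once = Suc.prems(3)
  let ?m = "Suc k"
  have braid: "\<And>p q i. g (p @ [i, Suc i, i] @ q) = g (p @ [Suc i, i, Suc i] @ q)"
    and quad: "\<And>p q. g (p @ [?m, ?m] @ q) = \<alpha> * g (p @ [?m] @ q) + \<beta> * g (p @ q)"
    using H Suc.prems(5) unfolding hecke_functional_def by blast+
  show ?case using Suc.prems(4)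
  proof (induction "count_list w ?m" arbitrary: w rule: less_induct)
    case less
    consider "count_list w ?m = 0" | "count_list w ?m = 1" | "2 \<le> count_list w ?m" by linarith
    then show ?case
    proof cases
      case 1
      then have "set w \<subseteq> {..<?m}" using less.prems by (auto simp: count_list_0_iff less_Suc_eq)
      then show ?thesis by (rule small)
    next
      case 2
      then have "?m \<in> set w" by (metis count_list_0_iff zero_neq_one)
      then obtain p q where w: "w = p @ ?m # q" by (meson split_list)
      with 2 have "?m \<notin> set p" "?m \<notin> set q" by (auto simp flip: count_list_0_iff)
      then have "set p \<subseteq> {..<?m}" "set q \<subseteq> {..<?m}"
        using less.prems w by (auto simp: less_Suc_eq)
      then show ?thesis using once w by simp
    next
      case 3
      then obtain p x q where w: "w = p @ [?m] @ x @ [?m] @ q" "?m \<notin> set x"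
        by (rule split_two_occurrences)
      have sets: "set p \<subseteq> {..<Suc ?m}" "set q \<subseteq> {..<Suc ?m}" "set x \<subseteq> {..<?m}"
        using less.prems w by (auto simp: less_Suc_eq)
      have fewer: "g w' = 0" if "count_list w' ?m < count_list w ?m" "set w' \<subseteq> {..<Suc ?m}" for w'
        using less.hyps that by blast
      \<comment> \<open>The word between two consecutive top letters lies one level lower. Freezing
        its surroundings lets the outer induction hypothesis replace it by words with
        \<open>k\<close> at most once. Without \<open>k\<close> the two top letters commute together
        and meet the quadratic relation; with one \<open>k\<close> the braid relation trades two top
        letters for one. Either way the count of \<open>?m\<close> drops.\<close>
      define h where "h = (\<lambda>x. g ((p @ [?m]) @ x @ ([?m] @ q)))"
      have "h x = 0"
      proof (rule Suc.IH)
        show "hecke_functional N \<alpha> \<beta> h" unfolding h_def by (rule hecke_functional_context[OF H])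
        show "set x \<subseteq> {..<Suc k}" "k < N" using sets Suc.prems(5) by simp_all
      next
        fix y assume y: "set y \<subseteq> {..<k}"
        then have "count_list y ?m = 0" by (auto simp: count_list_0_iff)
        moreover from y have "\<forall>i\<in>set y. Suc i < ?m" by auto
        then have "h y = g ((p @ y) @ [?m, ?m] @ q)"
          unfolding h_def using hecke_functional_commute[OF H, of y ?m p "[?m] @ q"] by simp
        ultimately show "h y = 0" unfolding quad
          using sets y w by (simp, subst (1 2) fewer) auto
      next
        fix y z assume y: "set y \<subseteq> {..<k}" and z: "set z \<subseteq> {..<k}"
        then have "count_list y ?m = 0" "count_list z ?m = 0" by (auto simp: count_list_0_iff)
        moreover have "\<forall>i\<in>set y. Suc i < ?m" "\<forall>i\<in>set z. Suc i < ?m" using y z by auto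
        then have "h (y @ [k] @ z) = g ((p @ y) @ [Suc k, k, Suc k] @ (z @ q))"
          unfolding h_def using hecke_functional_commute[OF H, of y ?m p "[k] @ z @ [?m] @ q"]
            hecke_functional_commute[OF H, of z ?m "p @ y @ [?m, k]" q] by simp
        ultimately show "h (y @ [k] @ z) = 0" unfolding braid[symmetric]
          using sets y z w by (simp, subst fewer) auto
      qed
      then show ?thesis unfolding h_def w by simp
    qed
  qed
qed


section \<open>Uniqueness of skein invariants\<close>

lemma link_invariantD: "link_invariant f \<Longrightarrow> same_closure m w n w' \<Longrightarrow> f m w = f n w'"
  unfolding link_invariant_def by blast

lemma braid_word_append [simp]:
  "braid_word n (p @ q) \<longleftrightarrow> braid_word n p \<and> braid_word n q"
  unfolding braid_word_def by auto

lemma braid_word_Cons [simp]: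
  "braid_word n (c # q) \<longleftrightarrow> Suc (strand c) < n \<and> braid_word n q"
  unfolding braid_word_def by auto

lemma braid_word_map_Pos: "braid_word (Suc n) (map Pos w) \<longleftrightarrow> set w \<subseteq> {..<n}"
  unfolding braid_word_def by auto

lemma skein_relationD:
  "skein_relation l l' z F \<Longrightarrow> braid_word n (p @ [Pos i] @ q) \<Longrightarrow>
    l * F n (p @ [Pos i] @ q) - l' * F n (p @ [Neg i] @ q) = z * F n (p @ q)"
  unfolding skein_relation_def by blast

text \<open>
  The value on a split unknot is a hypothesis because \<open>z\<close> may be a zero divisor: the skein
  relation alone determines \<open>F (Suc n) w\<close> only up to elements killed by \<open>z\<close>.
\<close>

lemma skein_invariant_vanishes:
  fixes F :: "nat \<Rightarrow> crossing list \<Rightarrow> 'a::comm_ring_1"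
  assumes inv: "link_invariant F" and skein: "skein_relation l l' z F"
    and "l dvd 1" "l' dvd 1"
    and split: "\<And>n w. braid_word n w \<Longrightarrow> F (Suc n) w = \<kappa> * F n w"
    and unknot: "F 1 [] = 0"
    and "braid_word n w"
  shows "F n w = 0"
proof -
  obtain k k' where k: "l * k = 1" and k': "l' * k' = 1" using assms(3,4) by (metis dvdE)
  \<comment> \<open>Off by one: \<open>n\<close> generators live on \<open>Suc n\<close> strands.
    Extension by zero makes \<open>g n\<close> total. The far and braid relations preserve the set
    of letters and so survive it everywhere; the quadratic relation deletes letters and can fail for
    a letter outside the alphabet, whence the bound in \<open>hecke_functional\<close>.\<close>
  define g where "g n w = (if set w \<subseteq> {..<n} then F (Suc n) (map Pos w) else 0)" for n w
  have hecke: "hecke_functional n (k * z) (k * l') (g n)" for n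
    unfolding hecke_functional_def
  proof (intro conjI allI impI)
    fix p q i j assume "Suc i < (j::nat)"
    then show "g n (p @ [i, j] @ q) = g n (p @ [j, i] @ q)"
      using link_invariantD[OF inv far[of i j "Suc n" "map Pos p" "map Pos q"]]
      by (auto simp: g_def braid_word_map_Pos)
  next
    fix p q i
    show "g n (p @ [i, Suc i, i] @ q) = g n (p @ [Suc i, i, Suc i] @ q)"
      using link_invariantD[OF inv braid[of "Suc n" "map Pos p" i "map Pos q"]]
      by (auto simp: g_def braid_word_map_Pos)
  next
    fix p q i assume "i < n"
    show "g n (p @ [i, i] @ q) = k * z * g n (p @ [i] @ q) + k * l' * g n (p @ q)"
    proof (cases "set p \<subseteq> {..<n} \<and> set q \<subseteq> {..<n}")
      case True
      let ?p = "map Pos p" and ?q = "map Pos q"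
      have bw: "braid_word (Suc n) ?p" "braid_word (Suc n) ?q"
        using True by (simp_all add: braid_word_map_Pos)
      \<comment> \<open>The quadratic relation is the skein relation at the second of two equal
        letters: switching it cancels both, smoothing it leaves one.\<close>
      have "F (Suc n) (?p @ [Pos i, Neg i] @ ?q) = F (Suc n) (?p @ ?q)"
        using \<open>i < n\<close> bw by (intro link_invariantD[OF inv cancel_Pos]) auto
      then have eq: "l * F (Suc n) (?p @ [Pos i, Pos i] @ ?q)
          = z * F (Suc n) (?p @ [Pos i] @ ?q) + l' * F (Suc n) (?p @ ?q)"
        using skein_relationD[OF skein, of "Suc n" "?p @ [Pos i]" i ?q] \<open>i < n\<close> bw
        by (simp add: algebra_simps)
      have "F (Suc n) (?p @ [Pos i, Pos i] @ ?q)
          = k * (l * F (Suc n) (?p @ [Pos i, Pos i] @ ?q))"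
        using k by (simp add: mult.assoc[symmetric] mult.commute[of k])
      also have "\<dots> = k * z * F (Suc n) (?p @ [Pos i] @ ?q) + k * l' * F (Suc n) (?p @ ?q)"
        unfolding eq by (simp add: algebra_simps)
      finally show ?thesis using True \<open>i < n\<close> by (simp add: g_def)
    next
      case False
      then show ?thesis by (auto simp: g_def)
    qed
  qed
  have positive: "set w \<subseteq> {..<n} \<Longrightarrow> F (Suc n) (map Pos w) = 0" for n w
  proof (induction n arbitrary: w)
    case 0
    then show ?case using unknot by simp
  next
    case (Suc n)
    have bw: "braid_word (Suc n) (map Pos w)" if "set w \<subseteq> {..<n}" for w
      using that by (simp add: braid_word_map_Pos)
    have "g (Suc n) w = 0"
    proof (rule hecke_functional_vanishes[OF hecke _ _ Suc.prems lessI])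
      \<comment> \<open>Letters below \<open>n\<close> leave the last strand idle, so the closure
        contains a split unknot and \<open>split\<close> removes it.\<close>
      fix x assume "set x \<subseteq> {..<n}"
      then show "g (Suc n) x = 0" using Suc.IH split[OF bw] by (simp add: g_def)
    next
      fix x y assume x: "set x \<subseteq> {..<n}" and y: "set y \<subseteq> {..<n}"
      \<comment> \<open>Conjugation carries the single top letter to the end of the word, where it
        is a stabilisation and can be undone.\<close>
      have "F (Suc (Suc n)) (map Pos x @ [Pos n] @ map Pos y)
          = F (Suc (Suc n)) (([Pos n] @ map Pos y) @ map Pos x)"
        using x y by (intro link_invariantD[OF inv cyclic]) (auto simp: braid_word_def)
      also have "\<dots> = F (Suc (Suc n)) ([Pos n] @ (map Pos y @ map Pos x))" by simp
      also have "\<dots> = F (Suc (Suc n)) ((map Pos y @ map Pos x) @ [Pos n])"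
        using x y by (intro link_invariantD[OF inv cyclic]) (auto simp: braid_word_def)
      also have "\<dots> = F (Suc n) (map Pos (y @ x))"
        using link_invariantD[OF inv stabilise_Pos[OF bw[of "y @ x"]]] x y by simp
      also have "\<dots> = 0" using Suc.IH[of "y @ x"] x y by simp
      finally show "g (Suc n) (x @ [n] @ y) = 0" by (simp add: g_def)
    qed
    then show ?case using Suc.prems by (simp add: g_def)
  qed
  \<comment> \<open>Negative letters are eliminated from left to right behind a growing positive
    prefix. The skein relation expresses \<open>l'\<close> times the value at a negative letter by
    words with fewer unprocessed letters, and \<open>l'\<close> is a unit.\<close>
  have mixed: "braid_word n (map Pos p @ w) \<Longrightarrow> F n (map Pos p @ w) = 0" for p w
  proof (induction w arbitrary: p)
    case Nil
    then obtain m where "n = Suc m" unfolding braid_word_def by (cases n) auto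
    then show ?case using positive Nil by (simp add: braid_word_map_Pos)
  next
    case (Cons c w)
    show ?case
    proof (cases c)
      case (Pos i)
      then show ?thesis using Cons.IH[of "p @ [i]"] Cons.prems by simp
    next
      case (Neg i)
      have "F n (map Pos p @ [Pos i] @ w) = 0" "F n (map Pos p @ w) = 0"
        using Cons.IH[of "p @ [i]"] Cons.IH[of p] Cons.prems Neg by simp_all
      then have "l' * F n (map Pos p @ [Neg i] @ w) = 0"
        using skein_relationD[OF skein, of n "map Pos p" i w] Cons.prems Neg by simp
      then have "k' * (l' * F n (map Pos p @ [Neg i] @ w)) = 0" by simp
      then show ?thesis using k' Neg by (simp add: mult.assoc[symmetric] mult.commute[of k'])
    qed
  qed
  show ?thesis using mixed[of "[]" w] assms(7) by simp
qed


section \<open>Kronecker products and traces\<close>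

lemma tensor_mat_dim [simp]:
  "dim_row (M \<otimes>\<^sub>t N) = dim_row M * dim_row N" "dim_col (M \<otimes>\<^sub>t N) = dim_col M * dim_col N"
  unfolding tensor_mat_def by simp_all

lemma tensor_mat_carrier [simp]:
  "M \<in> carrier_mat m n \<Longrightarrow> N \<in> carrier_mat p q \<Longrightarrow> M \<otimes>\<^sub>t N \<in> carrier_mat (m * p) (n * q)"
  unfolding carrier_mat_def by auto

lemma tensor_mat_index:
  "i < dim_row M * dim_row N \<Longrightarrow> j < dim_col M * dim_col N \<Longrightarrow> (M \<otimes>\<^sub>t N) $$ (i, j) =
    M $$ (i div dim_row N, j div dim_col N) * N $$ (i mod dim_row N, j mod dim_col N)"
  unfolding tensor_mat_def by simp

lemma div_mod_less_mult:
  assumes "(i::nat) < m * n"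
  shows "i div n < m" "i mod n < n"
proof -
  have "0 < n" using assms by (cases n) auto
  then show "i div n < m" "i mod n < n" using assms by (simp_all add: less_mult_imp_div_less)
qed

text \<open>Mixed-radix digits: an index of a triple product has the same middle and last digit
  whether the first two or the last two factors are grouped.\<close>

lemma div_mod_mult_nat: "(i::nat) div n mod m = i mod (m * n) div n" "i mod (m * n) mod n = i mod n"
proof -
  show "i mod (m * n) mod n = i mod n" by (simp add: mod_mod_cancel)
  show "i div n mod m = i mod (m * n) div n"
    by (cases "n = 0") (simp_all add: mod_mult2_eq mult.commute[of m])
qed

lemma sum_lessThan_mult:
  fixes f :: "nat \<Rightarrow> nat \<Rightarrow> 'b::comm_monoid_add"
  shows "(\<Sum>k<m * n. f (k div n) (k mod n)) = (\<Sum>i<m. \<Sum>j<n. f i j)"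
proof (cases "n = 0")
  case False
  have "(\<Sum>k<m * n. f (k div n) (k mod n)) = (\<Sum>i<m. \<Sum>k = i * n..<i * n + n. f (k div n) (k mod n))"
    by (simp add: sum.nat_group)
  also have "\<dots> = (\<Sum>i<m. \<Sum>j<n. f i j)"
  proof (rule sum.cong[OF HOL.refl])
    fix i
    have "(\<Sum>k = i * n..<i * n + n. f (k div n) (k mod n)) = (\<Sum>j<n. f ((j + i * n) div n) ((j + i * n) mod n))"
      using sum.shift_bounds_nat_ivl[of "\<lambda>k. f (k div n) (k mod n)" 0 "i * n" n]
      by (simp add: add.commute lessThan_atLeast0)
    then show "(\<Sum>k = i * n..<i * n + n. f (k div n) (k mod n)) = (\<Sum>j<n. f i j)"
      using False by simp
  qed
  finally show ?thesis .
qed simp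

text \<open>Lexicographic product bases make rebracketing the identity matrix, so associativity is
  an equality and no associators appear later.\<close>

lemma tensor_mat_assoc: "(M \<otimes>\<^sub>t N) \<otimes>\<^sub>t P = M \<otimes>\<^sub>t (N \<otimes>\<^sub>t P)"
proof (rule eq_matI)
  fix i j
  assume "i < dim_row (M \<otimes>\<^sub>t (N \<otimes>\<^sub>t P))" "j < dim_col (M \<otimes>\<^sub>t (N \<otimes>\<^sub>t P))"
  then have i: "i < dim_row M * dim_row N * dim_row P" and j: "j < dim_col M * dim_col N * dim_col P"
    by (simp_all add: ac_simps)
  note i' = div_mod_less_mult[OF i] and j' = div_mod_less_mult[OF j]
  have i2: "i mod (dim_row N * dim_row P) < dim_row N * dim_row P"
    using div_mod_less_mult[of i "dim_row M" "dim_row N * dim_row P"] i by (simp add: ac_simps)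
  have j2: "j mod (dim_col N * dim_col P) < dim_col N * dim_col P"
    using div_mod_less_mult[of j "dim_col M" "dim_col N * dim_col P"] j by (simp add: ac_simps)
  show "((M \<otimes>\<^sub>t N) \<otimes>\<^sub>t P) $$ (i, j) = (M \<otimes>\<^sub>t (N \<otimes>\<^sub>t P)) $$ (i, j)"
    using i j i' j' i2 j2
    by (simp add: tensor_mat_index mult.assoc[symmetric] div_mod_mult_nat
        div_mult2_eq[symmetric] mult.commute[of "dim_row P"] mult.commute[of "dim_col P"])
qed (simp_all add: ac_simps)

lemma tensor_mat_mult:
  assumes "dim_col M = dim_row M'" "dim_col N = dim_row N'"
  shows "(M \<otimes>\<^sub>t N) * (M' \<otimes>\<^sub>t N') = (M * M') \<otimes>\<^sub>t (N * N')"
proof (rule eq_matI)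
  fix i j
  assume "i < dim_row ((M * M') \<otimes>\<^sub>t (N * N'))" "j < dim_col ((M * M') \<otimes>\<^sub>t (N * N'))"
  then have i: "i < dim_row M * dim_row N" and j: "j < dim_col M' * dim_col N'" by simp_all
  note i' = div_mod_less_mult[OF i] and j' = div_mod_less_mult[OF j]
  have "((M \<otimes>\<^sub>t N) * (M' \<otimes>\<^sub>t N')) $$ (i, j)
      = (\<Sum>k<dim_row M' * dim_row N'. (M \<otimes>\<^sub>t N) $$ (i, k) * (M' \<otimes>\<^sub>t N') $$ (k, j))"
    using i j assms by (simp add: scalar_prod_def lessThan_atLeast0)
  also have "\<dots> = (\<Sum>k<dim_row M' * dim_row N'.
      (\<lambda>k1 k2. (M $$ (i div dim_row N, k1) * M' $$ (k1, j div dim_col N')) *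
        (N $$ (i mod dim_row N, k2) * N' $$ (k2, j mod dim_col N'))) (k div dim_row N') (k mod dim_row N'))"
    using i j assms by (intro sum.cong) (simp_all add: tensor_mat_index)
  also have "\<dots> = (\<Sum>k1<dim_row M'. M $$ (i div dim_row N, k1) * M' $$ (k1, j div dim_col N')) *
      (\<Sum>k2<dim_row N'. N $$ (i mod dim_row N, k2) * N' $$ (k2, j mod dim_col N'))"
    by (subst sum_lessThan_mult) (simp add: sum_product)
  also have "\<dots> = ((M * M') \<otimes>\<^sub>t (N * N')) $$ (i, j)"
    using i j i' j' assms by (simp add: tensor_mat_index scalar_prod_def lessThan_atLeast0)
  finally show "((M \<otimes>\<^sub>t N) * (M' \<otimes>\<^sub>t N')) $$ (i, j) = ((M * M') \<otimes>\<^sub>t (N * N')) $$ (i, j)" .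
qed simp_all

lemma tensor_mat_one [simp]: "1\<^sub>m m \<otimes>\<^sub>t 1\<^sub>m n = 1\<^sub>m (m * n)"
proof (rule eq_matI)
  fix i j assume "i < dim_row (1\<^sub>m (m * n))" "j < dim_col (1\<^sub>m (m * n))"
  then have i: "i < m * n" and j: "j < m * n" by simp_all
  have "i = j \<longleftrightarrow> i div n = j div n \<and> i mod n = j mod n" by (metis div_mult_mod_eq)
  then show "(1\<^sub>m m \<otimes>\<^sub>t 1\<^sub>m n) $$ (i, j) = 1\<^sub>m (m * n) $$ (i, j)"
    using i j div_mod_less_mult[OF i] div_mod_less_mult[OF j]
    by (auto simp: tensor_mat_index)
qed simp_all

lemma tensor_mat_one_left [simp]: "1\<^sub>m (Suc 0) \<otimes>\<^sub>t M = M"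
  by (rule eq_matI) (simp_all add: tensor_mat_index)

lemma tensor_mat_one_right [simp]: "M \<otimes>\<^sub>t 1\<^sub>m (Suc 0) = M"
  by (rule eq_matI) (simp_all add: tensor_mat_index)

lemma tensor_mat_add_left:
  "dim_row M = dim_row M' \<Longrightarrow> dim_col M = dim_col M' \<Longrightarrow> (M + M') \<otimes>\<^sub>t N = M \<otimes>\<^sub>t N + M' \<otimes>\<^sub>t N"
  by (rule eq_matI) (simp_all add: tensor_mat_index div_mod_less_mult algebra_simps)

lemma tensor_mat_add_right:
  "dim_row N = dim_row N' \<Longrightarrow> dim_col N = dim_col N' \<Longrightarrow> M \<otimes>\<^sub>t (N + N') = M \<otimes>\<^sub>t N + M \<otimes>\<^sub>t N'"
  by (rule eq_matI) (simp_all add: tensor_mat_index div_mod_less_mult algebra_simps)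

lemma tensor_mat_smult_left: "(k \<cdot>\<^sub>m M) \<otimes>\<^sub>t N = k \<cdot>\<^sub>m (M \<otimes>\<^sub>t N)"
  by (rule eq_matI) (simp_all add: tensor_mat_index div_mod_less_mult algebra_simps)

lemma tensor_mat_smult_right: "M \<otimes>\<^sub>t (k \<cdot>\<^sub>m N) = k \<cdot>\<^sub>m (M \<otimes>\<^sub>t N)"
  by (rule eq_matI) (simp_all add: tensor_mat_index div_mod_less_mult algebra_simps)

text \<open>Maps on disjoint strands commute because both composites are the same tensor product;
  far commutation of crossings rests on this.\<close>

lemma tensor_mat_interchange:
  assumes "M \<in> carrier_mat m m" "N \<in> carrier_mat n n"
  shows "(M \<otimes>\<^sub>t 1\<^sub>m n) * (1\<^sub>m m \<otimes>\<^sub>t N) = M \<otimes>\<^sub>t N" "(1\<^sub>m m \<otimes>\<^sub>t N) * (M \<otimes>\<^sub>t 1\<^sub>m n) = M \<otimes>\<^sub>t N"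
  using assms by (auto simp: tensor_mat_mult)

lemma tensor_pow_carrier [simp]:
  "M \<in> carrier_mat m m \<Longrightarrow> tensor_pow M n \<in> carrier_mat (m ^ n) (m ^ n)"
  by (induction n) auto

lemma tensor_pow_add: "tensor_pow M (m + n) = tensor_pow M m \<otimes>\<^sub>t tensor_pow M n"
  by (induction m) (simp_all add: tensor_mat_assoc)

section \<open>Trace, partial trace and Markov stabilisation\<close>

lemma mat_tr_mult_commute:
  assumes "M \<in> carrier_mat m n" "N \<in> carrier_mat n m"
  shows "mat_tr (M * N) = mat_tr (N * M)"
proof -
  have "mat_tr (M * N) = (\<Sum>i<m. \<Sum>j<n. M $$ (i, j) * N $$ (j, i))"
    using assms by (auto simp: mat_tr_def scalar_prod_def lessThan_atLeast0 intro!: sum.cong)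
  also have "\<dots> = (\<Sum>j<n. \<Sum>i<m. N $$ (j, i) * M $$ (i, j))"
    by (subst sum.swap) (simp add: mult.commute)
  also have "\<dots> = mat_tr (N * M)"
    using assms by (auto simp: mat_tr_def scalar_prod_def lessThan_atLeast0 intro!: sum.cong)
  finally show ?thesis .
qed

lemma mat_tr_linear:
  assumes "M \<in> carrier_mat n n" "N \<in> carrier_mat n n"
  shows "mat_tr (M + N) = mat_tr M + mat_tr N" "mat_tr (k \<cdot>\<^sub>m M) = k * mat_tr M"
  using assms by (simp_all add: mat_tr_def sum.distrib sum_distrib_left)

lemma mat_tr_tensor:
  assumes "M \<in> carrier_mat m m" "N \<in> carrier_mat n n"
  shows "mat_tr (M \<otimes>\<^sub>t N) = mat_tr M * mat_tr N"
proof -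
  have "mat_tr (M \<otimes>\<^sub>t N) = (\<Sum>k<m * n. (\<lambda>i j. M $$ (i, i) * N $$ (j, j)) (k div n) (k mod n))"
    using assms by (auto simp: mat_tr_def tensor_mat_index intro!: sum.cong)
  also have "\<dots> = mat_tr M * mat_tr N"
    using assms by (subst sum_lessThan_mult) (auto simp: mat_tr_def sum_product)
  finally show ?thesis .
qed

text \<open>The trace over the last tensor factor \<open>V\<close>, whose coordinate is the final
  binary digit of an index.\<close>

definition partial_tr :: "'a::comm_ring_1 mat \<Rightarrow> 'a mat" where
  "partial_tr M = mat (dim_row M div 2) (dim_col M div 2)
     (\<lambda>(i, j). \<Sum>k<2. M $$ (i * 2 + k, j * 2 + k))"

lemma mat_tr_partial_tr:
  assumes "M \<in> carrier_mat (n * 2) (n * 2)"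
  shows "mat_tr M = mat_tr (partial_tr M)"
proof -
  have "mat_tr M = (\<Sum>i<n * 2. (\<lambda>i k. M $$ (i * 2 + k, i * 2 + k)) (i div 2) (i mod 2))"
    using assms by (simp add: mat_tr_def)
  also have "\<dots> = (\<Sum>i<n. \<Sum>k<2. M $$ (i * 2 + k, i * 2 + k))"
    by (rule sum_lessThan_mult)
  also have "\<dots> = mat_tr (partial_tr M)"
    using assms by (simp add: mat_tr_def partial_tr_def)
  finally show ?thesis .
qed

text \<open>Operators on the remaining factors do not see the traced index. This pulls a whole braid
  out of the closure of the last strand.\<close>

lemma partial_tr_mult:
  assumes "X \<in> carrier_mat m n" "M \<in> carrier_mat (n * 2) (p * 2)"
  shows "partial_tr ((X \<otimes>\<^sub>t 1\<^sub>m 2) * M) = X * partial_tr M"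
proof (rule eq_matI)
  fix i j assume "i < dim_row (X * partial_tr M)" "j < dim_col (X * partial_tr M)"
  then have i: "i < m" and j: "j < p" using assms by (auto simp: partial_tr_def)
  have entry: "((X \<otimes>\<^sub>t 1\<^sub>m 2) * M) $$ (i * 2 + k, j * 2 + k)
      = (\<Sum>s<n. X $$ (i, s) * M $$ (s * 2 + k, j * 2 + k))" if k: "k < 2" for k
  proof -
    have ik: "i * 2 + k < m * 2" "j * 2 + k < p * 2" using i j k by linarith+
    have "((X \<otimes>\<^sub>t 1\<^sub>m 2) * M) $$ (i * 2 + k, j * 2 + k)
      = (\<Sum>r<n * 2. (\<lambda>s t. X $$ (i, s) * 1\<^sub>m 2 $$ (k, t) * M $$ (s * 2 + t, j * 2 + k)) (r div 2) (r mod 2))"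
      using assms ik k by (auto simp: scalar_prod_def lessThan_atLeast0 tensor_mat_index intro!: sum.cong)
    also have "\<dots> = (\<Sum>s<n. \<Sum>t<2. X $$ (i, s) * 1\<^sub>m 2 $$ (k, t) * M $$ (s * 2 + t, j * 2 + k))"
      by (rule sum_lessThan_mult)
    also have "\<dots> = (\<Sum>s<n. X $$ (i, s) * M $$ (s * 2 + k, j * 2 + k))"
      using k by (auto simp: numeral_2_eq_2 less_Suc_eq)
    finally show ?thesis .
  qed
  have "partial_tr ((X \<otimes>\<^sub>t 1\<^sub>m 2) * M) $$ (i, j)
      = (\<Sum>k<2. ((X \<otimes>\<^sub>t 1\<^sub>m 2) * M) $$ (i * 2 + k, j * 2 + k))"
    using assms i j by (auto simp: partial_tr_def)
  also have "\<dots> = (\<Sum>k<2. \<Sum>s<n. X $$ (i, s) * M $$ (s * 2 + k, j * 2 + k))"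
    by (rule sum.cong) (auto simp: entry)
  also have "\<dots> = (\<Sum>s<n. X $$ (i, s) * (\<Sum>k<2. M $$ (s * 2 + k, j * 2 + k)))"
    by (subst sum.swap) (simp add: sum_distrib_left)
  also have "\<dots> = (X * partial_tr M) $$ (i, j)"
    using assms i j by (auto simp: partial_tr_def scalar_prod_def lessThan_atLeast0 intro!: sum.cong)
  finally show "partial_tr ((X \<otimes>\<^sub>t 1\<^sub>m 2) * M) $$ (i, j) = (X * partial_tr M) $$ (i, j)" .
qed (use assms in \<open>auto simp: partial_tr_def\<close>)

lemma partial_tr_tensor:
  assumes "Y \<in> carrier_mat 4 4"
  shows "partial_tr (1\<^sub>m n \<otimes>\<^sub>t Y) = 1\<^sub>m n \<otimes>\<^sub>t partial_tr Y"
proof (rule eq_matI)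
  fix i j assume "i < dim_row (1\<^sub>m n \<otimes>\<^sub>t partial_tr Y)" "j < dim_col (1\<^sub>m n \<otimes>\<^sub>t partial_tr Y)"
  then have i: "i < n * 2" and j: "j < n * 2" using assms by (auto simp: partial_tr_def)
  have idx: "(h * 2 + k) div 4 = h div 2" "(h * 2 + k) mod 4 = h mod 2 * 2 + k" if "k < 2" for h k :: nat
    using that by presburger+
  have "i * 2 + k < n * 4" "j * 2 + k < n * 4" if "k < 2" for k using i j that by linarith+
  then show "partial_tr (1\<^sub>m n \<otimes>\<^sub>t Y) $$ (i, j) = (1\<^sub>m n \<otimes>\<^sub>t partial_tr Y) $$ (i, j)"
    using assms i j div_mod_less_mult[OF i] div_mod_less_mult[OF j]
    by (simp add: partial_tr_def tensor_mat_index idx sum_distrib_left)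
qed (use assms in \<open>auto simp: partial_tr_def\<close>)

text \<open>Closing the last strand first leaves only the scalar \<open>s\<close>, so the full trace
  factors. Here \<open>n\<close> is the dimension of all factors except the two on which
  \<open>S\<close> acts, and \<open>X\<close> acts on all factors but the last.\<close>

lemma mat_tr_stabilise:
  assumes X: "X \<in> carrier_mat (n * 2) (n * 2)" and N: "N \<in> carrier_mat 2 2" and S: "S \<in> carrier_mat 4 4"
    and tr: "partial_tr ((1\<^sub>m 2 \<otimes>\<^sub>t N) * S) = s \<cdot>\<^sub>m 1\<^sub>m 2"
  shows "mat_tr ((X \<otimes>\<^sub>t N) * (1\<^sub>m n \<otimes>\<^sub>t S)) = s * mat_tr X"
proof -
  let ?Y = "(1\<^sub>m 2 \<otimes>\<^sub>t N) * S"
  have Y: "?Y \<in> carrier_mat 4 4" using tensor_mat_carrier[OF one_carrier_mat[of 2] N] S by auto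
  have "(X \<otimes>\<^sub>t N) * (1\<^sub>m n \<otimes>\<^sub>t S) = (X \<otimes>\<^sub>t 1\<^sub>m 2) * (1\<^sub>m (n * 2) \<otimes>\<^sub>t N) * (1\<^sub>m n \<otimes>\<^sub>t S)"
    using tensor_mat_interchange(1)[OF X N] by simp
  also have "1\<^sub>m (n * 2) \<otimes>\<^sub>t N = 1\<^sub>m n \<otimes>\<^sub>t (1\<^sub>m 2 \<otimes>\<^sub>t N)"
    by (simp flip: tensor_mat_one tensor_mat_assoc)
  also have "(X \<otimes>\<^sub>t 1\<^sub>m 2) * (1\<^sub>m n \<otimes>\<^sub>t (1\<^sub>m 2 \<otimes>\<^sub>t N)) * (1\<^sub>m n \<otimes>\<^sub>t S)
      = (X \<otimes>\<^sub>t 1\<^sub>m 2) * ((1\<^sub>m n \<otimes>\<^sub>t (1\<^sub>m 2 \<otimes>\<^sub>t N)) * (1\<^sub>m n \<otimes>\<^sub>t S))"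
    using X N S by (intro assoc_mult_mat[of _ "n * 4" "n * 4" _ "n * 4" _ "n * 4"]) auto
  also have "(1\<^sub>m n \<otimes>\<^sub>t (1\<^sub>m 2 \<otimes>\<^sub>t N)) * (1\<^sub>m n \<otimes>\<^sub>t S) = 1\<^sub>m n \<otimes>\<^sub>t ?Y"
    using N S by (subst tensor_mat_mult) auto
  finally have eq: "(X \<otimes>\<^sub>t N) * (1\<^sub>m n \<otimes>\<^sub>t S) = (X \<otimes>\<^sub>t 1\<^sub>m 2) * (1\<^sub>m n \<otimes>\<^sub>t ?Y)" .
  have c: "1\<^sub>m n \<otimes>\<^sub>t ?Y \<in> carrier_mat (n * 2 * 2) (n * 2 * 2)"
    using tensor_mat_carrier[OF one_carrier_mat[of n] Y] by (simp add: mult.assoc)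
  have "mat_tr ((X \<otimes>\<^sub>t N) * (1\<^sub>m n \<otimes>\<^sub>t S)) = mat_tr (partial_tr ((X \<otimes>\<^sub>t 1\<^sub>m 2) * (1\<^sub>m n \<otimes>\<^sub>t ?Y)))"
    unfolding eq
    by (rule mat_tr_partial_tr[of _ "n * 2"]) (use X c in \<open>auto intro!: mult_carrier_mat tensor_mat_carrier\<close>)
  also have "\<dots> = mat_tr (X * (1\<^sub>m n \<otimes>\<^sub>t (s \<cdot>\<^sub>m 1\<^sub>m 2)))"
    by (simp only: partial_tr_mult[OF X c] partial_tr_tensor[OF Y] tr)
  also have "\<dots> = s * mat_tr X"
    using X by (simp add: tensor_mat_smult_right mult_smult_distrib[OF X one_carrier_mat] mat_tr_linear[OF X X])
  finally show ?thesis .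
qed


section \<open>Switchback pairs\<close>

definition switchback_pair :: "'a::comm_ring_1 mat \<Rightarrow> 'a mat \<Rightarrow> bool" where
  "switchback_pair \<beta> \<gamma> \<longleftrightarrow> \<beta> \<in> carrier_mat 1 4 \<and> \<gamma> \<in> carrier_mat 4 1 \<and>
     (\<beta> \<otimes>\<^sub>t 1\<^sub>m 2) * (1\<^sub>m 2 \<otimes>\<^sub>t \<gamma>) = 1\<^sub>m 2 \<and> (1\<^sub>m 2 \<otimes>\<^sub>t \<beta>) * (\<gamma> \<otimes>\<^sub>t 1\<^sub>m 2) = 1\<^sub>m 2"

lemma less_two_cases: "(i::nat) < 2 \<longleftrightarrow> i = 0 \<or> i = 1"
  by auto

lemma atLeastLessThan_enum: "{0..<8::nat} = {0, 1, 2, 3, 4, 5, 6, 7}" "{0..<4::nat} = {0, 1, 2, 3}"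
  by auto

lemma sum_lessThan_two: "(\<Sum>k<2. f k) = f 0 + f (1::nat)"
  by (simp add: numeral_2_eq_2)

text \<open>Read \<beta> and \<gamma> as 2 by 2 matrices \<open>B\<close> and \<open>C\<close>, with
  \<open>B i j = \<beta> $$ (0, i * 2 + j)\<close> and likewise for \<gamma>. The first zigzag is
  the transpose of \<open>B C\<close>, which explains the swapped indices, and the second is
  \<open>C B\<close>. A switchback pair is thus a pair of mutually inverse matrices.\<close>

lemma switchback_entry:
  assumes "\<beta> \<in> carrier_mat 1 4" "\<gamma> \<in> carrier_mat 4 1" "i < 2" "j < 2"
  shows "((\<beta> \<otimes>\<^sub>t 1\<^sub>m 2) * (1\<^sub>m 2 \<otimes>\<^sub>t \<gamma>)) $$ (j, i) = (\<Sum>k<2. \<beta> $$ (0, i * 2 + k) * \<gamma> $$ (k * 2 + j, 0))"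
    and "((1\<^sub>m 2 \<otimes>\<^sub>t \<beta>) * (\<gamma> \<otimes>\<^sub>t 1\<^sub>m 2)) $$ (i, j) = (\<Sum>k<2. \<gamma> $$ (i * 2 + k, 0) * \<beta> $$ (0, k * 2 + j))"
  using assms
  by (auto simp: less_two_cases scalar_prod_def tensor_mat_index atLeastLessThan_enum sum_lessThan_two algebra_simps
      simp flip: numeral_2_eq_2)

lemma switchback_pairD:
  assumes "switchback_pair \<beta> \<gamma>" "i < 2" "j < 2"
  shows "(\<Sum>k<2. \<beta> $$ (0, i * 2 + k) * \<gamma> $$ (k * 2 + j, 0)) = (if i = j then 1 else 0)"
    and "(\<Sum>k<2. \<gamma> $$ (i * 2 + k, 0) * \<beta> $$ (0, k * 2 + j)) = (if i = j then 1 else 0)"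
proof -
  have c: "\<beta> \<in> carrier_mat 1 4" "\<gamma> \<in> carrier_mat 4 1"
    and eqs: "(\<beta> \<otimes>\<^sub>t 1\<^sub>m 2) * (1\<^sub>m 2 \<otimes>\<^sub>t \<gamma>) = 1\<^sub>m 2" "(1\<^sub>m 2 \<otimes>\<^sub>t \<beta>) * (\<gamma> \<otimes>\<^sub>t 1\<^sub>m 2) = 1\<^sub>m 2"
    using assms(1) by (simp_all add: switchback_pair_def)
  show "(\<Sum>k<2. \<beta> $$ (0, i * 2 + k) * \<gamma> $$ (k * 2 + j, 0)) = (if i = j then 1 else 0)"
    unfolding switchback_entry(1)[OF c assms(2,3), symmetric] eqs using assms by auto
  show "(\<Sum>k<2. \<gamma> $$ (i * 2 + k, 0) * \<beta> $$ (0, k * 2 + j)) = (if i = j then 1 else 0)"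
    unfolding switchback_entry(2)[OF c assms(2,3), symmetric] eqs using assms by auto
qed

lemma switchback_pairI:
  assumes "\<beta> \<in> carrier_mat 1 4" "\<gamma> \<in> carrier_mat 4 1"
    and "\<And>i j. i < 2 \<Longrightarrow> j < 2 \<Longrightarrow> (\<Sum>k<2. \<beta> $$ (0, i * 2 + k) * \<gamma> $$ (k * 2 + j, 0)) = (if i = j then 1 else 0)"
    and "\<And>i j. i < 2 \<Longrightarrow> j < 2 \<Longrightarrow> (\<Sum>k<2. \<gamma> $$ (i * 2 + k, 0) * \<beta> $$ (0, k * 2 + j)) = (if i = j then 1 else 0)"
  shows "switchback_pair \<beta> \<gamma>"
proof -
  have "(\<beta> \<otimes>\<^sub>t 1\<^sub>m 2) * (1\<^sub>m 2 \<otimes>\<^sub>t \<gamma>) = 1\<^sub>m 2" "(1\<^sub>m 2 \<otimes>\<^sub>t \<beta>) * (\<gamma> \<otimes>\<^sub>t 1\<^sub>m 2) = 1\<^sub>m 2"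
    using assms switchback_entry[OF assms(1,2)] by (auto intro!: eq_matI)
  then show ?thesis using assms(1,2) by (simp add: switchback_pair_def)
qed

lemma switchback_2cocycleD:
  assumes "switchback_2cocycle \<beta> \<gamma> \<beta>1 \<gamma>1" "\<beta> \<in> carrier_mat 1 4" "\<gamma> \<in> carrier_mat 4 1" "i < 2" "j < 2"
  shows "(\<Sum>k<2. \<beta> $$ (0, i * 2 + k) * \<gamma>1 $$ (k * 2 + j, 0)) + (\<Sum>k<2. \<beta>1 $$ (0, i * 2 + k) * \<gamma> $$ (k * 2 + j, 0)) = 0"
    and "(\<Sum>k<2. \<gamma>1 $$ (i * 2 + k, 0) * \<beta> $$ (0, k * 2 + j)) + (\<Sum>k<2. \<gamma> $$ (i * 2 + k, 0) * \<beta>1 $$ (0, k * 2 + j)) = 0"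
proof -
  have c: "\<beta>1 \<in> carrier_mat 1 4" "\<gamma>1 \<in> carrier_mat 4 1"
    and eqs: "(\<beta> \<otimes>\<^sub>t 1\<^sub>m 2) * (1\<^sub>m 2 \<otimes>\<^sub>t \<gamma>1) + (\<beta>1 \<otimes>\<^sub>t 1\<^sub>m 2) * (1\<^sub>m 2 \<otimes>\<^sub>t \<gamma>) = 0\<^sub>m 2 2"
      "(1\<^sub>m 2 \<otimes>\<^sub>t \<beta>) * (\<gamma>1 \<otimes>\<^sub>t 1\<^sub>m 2) + (1\<^sub>m 2 \<otimes>\<^sub>t \<beta>1) * (\<gamma> \<otimes>\<^sub>t 1\<^sub>m 2) = 0\<^sub>m 2 2"
    using assms(1) by (simp_all add: switchback_2cocycle_def)
  note entries = switchback_entry[OF assms(2) c(2) assms(4,5)] switchback_entry[OF c(1) assms(3,4,5)]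
  have "((\<beta> \<otimes>\<^sub>t 1\<^sub>m 2) * (1\<^sub>m 2 \<otimes>\<^sub>t \<gamma>1)) $$ (j, i) + ((\<beta>1 \<otimes>\<^sub>t 1\<^sub>m 2) * (1\<^sub>m 2 \<otimes>\<^sub>t \<gamma>)) $$ (j, i) = 0"
    using arg_cong[OF eqs(1), of "\<lambda>M. M $$ (j, i)"] assms c by (simp del: index_mult_mat(1))
  then show "(\<Sum>k<2. \<beta> $$ (0, i * 2 + k) * \<gamma>1 $$ (k * 2 + j, 0)) + (\<Sum>k<2. \<beta>1 $$ (0, i * 2 + k) * \<gamma> $$ (k * 2 + j, 0)) = 0"
    unfolding entries .
  have "((1\<^sub>m 2 \<otimes>\<^sub>t \<beta>) * (\<gamma>1 \<otimes>\<^sub>t 1\<^sub>m 2)) $$ (i, j) + ((1\<^sub>m 2 \<otimes>\<^sub>t \<beta>1) * (\<gamma> \<otimes>\<^sub>t 1\<^sub>m 2)) $$ (i, j) = 0"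
    using arg_cong[OF eqs(2), of "\<lambda>M. M $$ (i, j)"] assms c by (simp del: index_mult_mat(1))
  then show "(\<Sum>k<2. \<gamma>1 $$ (i * 2 + k, 0) * \<beta> $$ (0, k * 2 + j)) + (\<Sum>k<2. \<gamma> $$ (i * 2 + k, 0) * \<beta>1 $$ (0, k * 2 + j)) = 0"
    unfolding entries .
qed

section \<open>Truncated scalars and the deformed pair\<close>

lemma trunc_const_simps:
  "trunc_const 0 = 0" "trunc_const 1 = 1"
  "trunc_const (x + y) = trunc_const x + trunc_const y"
  "trunc_const (x * y) = trunc_const x * trunc_const y"
  by (transfer, simp add: trunc_rel_def one_pCons)+

lemma trunc_var_squared: "trunc_var * trunc_var = (0 :: 'a::comm_ring_1 trunc)"
  by transfer (simp add: trunc_rel_def monom_altdef power2_eq_square)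

lemma switchback_pair_deform:
  assumes sb: "switchback_pair \<beta> \<gamma>" and co: "switchback_2cocycle \<beta> \<gamma> \<beta>1 \<gamma>1"
  shows "switchback_pair (deform \<beta> \<beta>1) (deform \<gamma> \<gamma>1)"
proof (rule switchback_pairI)
  have c: "\<beta> \<in> carrier_mat 1 4" "\<gamma> \<in> carrier_mat 4 1" "\<beta>1 \<in> carrier_mat 1 4" "\<gamma>1 \<in> carrier_mat 4 1"
    using sb co by (simp_all add: switchback_pair_def switchback_2cocycle_def)
  then show "deform \<beta> \<beta>1 \<in> carrier_mat 1 4" "deform \<gamma> \<gamma>1 \<in> carrier_mat 4 1"
    by (simp_all add: deform_def)
  have idx: "deform \<beta> \<beta>1 $$ (0, j) = trunc_const (\<beta> $$ (0, j)) + trunc_var * trunc_const (\<beta>1 $$ (0, j))"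
    "deform \<gamma> \<gamma>1 $$ (j, 0) = trunc_const (\<gamma> $$ (j, 0)) + trunc_var * trunc_const (\<gamma>1 $$ (j, 0))"
    if "j < 4" for j using c that by (auto simp: deform_def)
  \<comment> \<open>The \<open>t^2\<close> term dies in the truncated ring, and the first-order
    coefficient, summed over \<open>k\<close>, is the expression that the cocycle condition makes
    zero.\<close>
  have prod: "(trunc_const p + trunc_var * trunc_const p1) * (trunc_const q + trunc_var * trunc_const q1)
      = trunc_const (p * q) + trunc_var * trunc_const (p * q1 + p1 * q)" for p p1 q q1 :: 'a
  proof -
    have "(trunc_const p + trunc_var * trunc_const p1) * (trunc_const q + trunc_var * trunc_const q1)
      = trunc_const (p * q) + trunc_var * trunc_const (p * q1 + p1 * q)
        + trunc_var * trunc_var * trunc_const (p1 * q1)"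
      by (simp add: trunc_const_simps algebra_simps)
    then show ?thesis by (simp add: trunc_var_squared)
  qed
  have comb: "trunc_const p + trunc_var * trunc_const p1 + (trunc_const q + trunc_var * trunc_const q1)
      = trunc_const (p + q) + trunc_var * trunc_const (p1 + q1)" for p p1 q q1 :: 'a
    by (simp add: trunc_const_simps algebra_simps)
  fix i j :: nat assume ij: "i < 2" "j < 2"
  then have lt: "i * 2 < 4" "i * 2 + 1 < 4" "0 * 2 + j < 4" "1 * 2 + j < 4" by auto
  show "(\<Sum>k<2. deform \<beta> \<beta>1 $$ (0, i * 2 + k) * deform \<gamma> \<gamma>1 $$ (k * 2 + j, 0)) = (if i = j then 1 else 0)"
    unfolding sum_lessThan_two add_0_right idx[OF lt(1)] idx[OF lt(2)] idx[OF lt(3)] idx[OF lt(4)] prod comb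
    using switchback_pairD(1)[OF sb ij] switchback_2cocycleD(1)[OF co c(1,2) ij]
    by (auto simp: sum_lessThan_two trunc_const_simps algebra_simps)
  show "(\<Sum>k<2. deform \<gamma> \<gamma>1 $$ (i * 2 + k, 0) * deform \<beta> \<beta>1 $$ (0, k * 2 + j)) = (if i = j then 1 else 0)"
    unfolding sum_lessThan_two add_0_right idx[OF lt(1)] idx[OF lt(2)] idx[OF lt(3)] idx[OF lt(4)] prod comb
    using switchback_pairD(2)[OF sb ij] switchback_2cocycleD(2)[OF co c(1,2) ij]
    by (auto simp: sum_lessThan_two trunc_const_simps algebra_simps)
qed

text \<open>Here \<open>B\<close> and \<open>C\<close> are the same antidiagonal matrix, whose
  square is \<open>- (im * im * A * A')\<close> times the identity; this is where the imaginary unit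
  is essential.\<close>

lemma switchback_pair_kauffman:
  fixes im A A' :: "'a::comm_ring_1"
  assumes "im * im = - 1" "A * A' = 1"
  shows "switchback_pair (kauffman_\<beta> im A A') (kauffman_\<gamma> im A A')"
proof -
  have "A * (A' * (im * im)) = A * A' * (im * im)" by (simp add: mult.assoc)
  then have eq: "A * (A' * (im * im)) = - 1" using assms by simp
  show ?thesis
    by (rule switchback_pairI)
      (auto simp: eq kauffman_\<beta>_def kauffman_\<gamma>_def mat_of_rows_list_def less_two_cases
        sum_lessThan_two algebra_simps
      simp flip: numeral_2_eq_2)
qed

text \<open>A tensor product acts on \<open>C\<close> by congruence: the right-hand side is the
  \<open>(i, j)\<close> entry of \<open>M C N^T\<close>. Dually, the next lemma gives
  \<open>M^T B N\<close>.\<close>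

lemma tensor_mult_column_entry:
  assumes "M \<in> carrier_mat 2 2" "N \<in> carrier_mat 2 2" "\<gamma> \<in> carrier_mat 4 1" "i < 2" "j < 2"
  shows "((M \<otimes>\<^sub>t N) * \<gamma>) $$ (i * 2 + j, 0) = (\<Sum>k<2. M $$ (i, k) * (\<Sum>l<2. N $$ (j, l) * \<gamma> $$ (k * 2 + l, 0)))"
  using assms
  by (auto simp: less_two_cases scalar_prod_def tensor_mat_index atLeastLessThan_enum sum_lessThan_two algebra_simps
      simp flip: numeral_2_eq_2)

lemma row_mult_tensor_entry:
  assumes "M \<in> carrier_mat 2 2" "N \<in> carrier_mat 2 2" "\<beta> \<in> carrier_mat 1 4" "i < 2" "j < 2"
  shows "(\<beta> * (M \<otimes>\<^sub>t N)) $$ (0, i * 2 + j) = (\<Sum>k<2. (\<Sum>l<2. \<beta> $$ (0, k * 2 + l) * N $$ (l, j)) * M $$ (k, i))"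
  using assms
  by (auto simp: less_two_cases scalar_prod_def tensor_mat_index atLeastLessThan_enum sum_lessThan_two algebra_simps
      simp flip: numeral_2_eq_2)

lemma nu_mat_carrier [simp]:
  "\<beta> \<in> carrier_mat 1 4 \<Longrightarrow> \<gamma> \<in> carrier_mat 4 1 \<Longrightarrow> nu_mat \<beta> \<gamma> \<in> carrier_mat 2 2"
  by (auto simp: nu_mat_def)

text \<open>In matrix form \<nu> is \<open>C B^T\<close>; for a switchback pair it is
  \<open>C\<close> times its own inverse transpose, so it measures how far \<gamma> is from being
  symmetric.\<close>

lemma nu_mat_entry:
  assumes "\<beta> \<in> carrier_mat 1 4" "\<gamma> \<in> carrier_mat 4 1" "i < 2" "j < 2"
  shows "nu_mat \<beta> \<gamma> $$ (i, j) = (\<Sum>k<2. \<gamma> $$ (i * 2 + k, 0) * \<beta> $$ (0, j * 2 + k))"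
  using assms
  by (auto simp: nu_mat_def transposition_def mat_of_rows_list_def less_two_cases scalar_prod_def
      tensor_mat_index atLeastLessThan_enum sum_lessThan_two algebra_simps
      simp flip: numeral_2_eq_2)


section \<open>The enhanced R-matrix of a switchback pair\<close>

lemma ring_inv_right: "x dvd 1 \<Longrightarrow> x * ring_inv x = 1"
  unfolding ring_inv_def
proof (rule theI')
  assume "x dvd 1"
  then obtain y where y: "x * y = 1" by (metis dvdE)
  then show "\<exists>!y. x * y = 1" by (metis mult.assoc mult.commute mult_1)
qed

lemma ring_inv_unique: "x * y = 1 \<Longrightarrow> ring_inv x = y"
  by (metis dvdI mult.assoc mult.commute mult_1 ring_inv_right)

text \<open>Writing an integer exponent as a difference of naturals spares the sign cases when
  exponents are added.\<close>

lemma unit_power_diff: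
  assumes "x dvd 1"
  shows "unit_power x (int m - int n) = x ^ m * ring_inv x ^ n"
proof -
  have x: "x * ring_inv x = 1" by (rule ring_inv_right[OF assms])
  consider k where "m = n + k" | k where "n = m + k" by (metis le_iff_add linear)
  then show ?thesis
  proof cases
    case 1
    have "x ^ m * ring_inv x ^ n = x ^ k * (x * ring_inv x) ^ n"
      unfolding 1 power_add power_mult_distrib by (simp only: ac_simps)
    then show ?thesis using 1 by (simp add: unit_power_def x)
  next
    case 2
    have "x ^ m * ring_inv x ^ n = ring_inv x ^ k * (x * ring_inv x) ^ m"
      unfolding 2 power_add power_mult_distrib by (simp only: ac_simps)
    then show ?thesis using 2 by (cases k) (simp_all add: unit_power_def x nat_add_distrib)
  qed
qed

lemma unit_power_add:
  assumes "x dvd 1"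
  shows "unit_power x (i + j) = unit_power x i * unit_power x j"
proof -
  obtain m n p q where i: "i = int m - int n" and j: "j = int p - int q"
    by (metis int_diff_cases)
  have "i + j = int (m + p) - int (n + q)" using i j by simp
  then show ?thesis
    by (simp only: i j unit_power_diff[OF assms] power_add ac_simps)
qed

lemma unit_power_one [simp]: "unit_power x 0 = 1" "unit_power x 1 = x" "unit_power x (- 1) = ring_inv x"
  by (simp_all add: unit_power_def)

lemma mat_inv_eqI:
  assumes "M \<in> carrier_mat n n" "N \<in> carrier_mat n n" "M * N = 1\<^sub>m n" "N * M = 1\<^sub>m n"
  shows "mat_inv M = N"
  unfolding mat_inv_def
proof (rule the_equality)
  show "N \<in> carrier_mat (dim_col M) (dim_row M) \<and> inverts_mat M N \<and> inverts_mat N M"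
    using assms by (auto simp: inverts_mat_def)
  fix N' assume N': "N' \<in> carrier_mat (dim_col M) (dim_row M) \<and> inverts_mat M N' \<and> inverts_mat N' M"
  then have c: "N' \<in> carrier_mat n n" and inv: "N' * M = 1\<^sub>m n"
    using assms by (auto simp: inverts_mat_def)
  have "N' = N' * (M * N)" using c assms by simp
  also have "\<dots> = (N' * M) * N" using c assms by (metis assoc_mult_mat)
  finally show "N' = N" using inv assms by simp
qed

section \<open>The Yang-Baxter equation from the Temperley-Lieb relations\<close>

lemma mult_expand:
  fixes X Y :: "'a::comm_ring_1 mat"
  assumes "X \<in> carrier_mat n n" "Y \<in> carrier_mat n n"
  shows "(p \<cdot>\<^sub>m 1\<^sub>m n + q \<cdot>\<^sub>m X) * (p' \<cdot>\<^sub>m 1\<^sub>m n + q' \<cdot>\<^sub>m Y)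
    = (p * p') \<cdot>\<^sub>m 1\<^sub>m n + (p * q') \<cdot>\<^sub>m Y + (q * p') \<cdot>\<^sub>m X + (q * q') \<cdot>\<^sub>m (X * Y)"
proof -
  note distribs = add_mult_distrib_mat[of _ n n _ _ n] mult_add_distrib_mat[of _ n n _ n]
    mult_smult_distrib[of _ n n _ n] mult_smult_assoc_mat[of _ n n _ n]
  show ?thesis using assms
    by (intro eq_matI) (auto simp: distribs algebra_simps simp del: index_mult_mat(1))
qed

text \<open>After expanding \<open>P * Q * P\<close>, everything is symmetric in \<open>X\<close>
  and \<open>Y\<close> except that the coefficient of \<open>X\<close> exceeds that of
  \<open>Y\<close> by \<open>b * (a^2 + b^2 + d * a * b)\<close>, because \<open>X * X\<close> and
  \<open>X * Y * X\<close> both collapse to multiples of \<open>X\<close>. The relation makes the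
  excess vanish.\<close>

lemma yang_baxter:
  fixes X Y :: "'a::comm_ring_1 mat"
  assumes X: "X \<in> carrier_mat n n" and Y: "Y \<in> carrier_mat n n"
    and XX: "X * X = d \<cdot>\<^sub>m X" and YY: "Y * Y = d \<cdot>\<^sub>m Y"
    and XYX: "X * Y * X = X" and YXY: "Y * X * Y = Y"
    and rel: "a^2 + b^2 + d * a * b = 0"
  defines "P \<equiv> a \<cdot>\<^sub>m 1\<^sub>m n + b \<cdot>\<^sub>m X" and "Q \<equiv> a \<cdot>\<^sub>m 1\<^sub>m n + b \<cdot>\<^sub>m Y"
  shows "P * Q * P = Q * P * Q"
proof -
  have *: "(a \<cdot>\<^sub>m 1\<^sub>m n + b \<cdot>\<^sub>m X) * (a \<cdot>\<^sub>m 1\<^sub>m n + b \<cdot>\<^sub>m Y) * (a \<cdot>\<^sub>m 1\<^sub>m n + b \<cdot>\<^sub>m X)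
      = (a^3) \<cdot>\<^sub>m 1\<^sub>m n + (a^2 * b) \<cdot>\<^sub>m X + (a^2 * b) \<cdot>\<^sub>m Y + (a * b^2) \<cdot>\<^sub>m (X * Y + Y * X)"
    if X: "X \<in> carrier_mat n n" and Y: "Y \<in> carrier_mat n n"
      and XX: "X * X = d \<cdot>\<^sub>m X" and XYX: "X * Y * X = X" for X Y :: "'a mat"
  proof -
    note distribs = add_mult_distrib_mat[of _ n n _ _ n] mult_add_distrib_mat[of _ n n _ n]
      mult_smult_distrib[of _ n n _ n] mult_smult_assoc_mat[of _ n n _ n]
    have "b * a * a + b * a * b * d + b * b * b = b * (a^2 + b^2 + d * a * b)"
      by (simp add: power2_eq_square algebra_simps)
    also have "\<dots> = 0" using rel by simp
    finally have "a * a * b + (b * a * a + b * a * b * d + b * b * b) = a * a * b" by simp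
    then have b3: "a * a * b + b * a * a + b * a * b * d + b * b * b = a * a * b"
      by (simp only: add.assoc)
    have "(a \<cdot>\<^sub>m 1\<^sub>m n + b \<cdot>\<^sub>m X) * (a \<cdot>\<^sub>m 1\<^sub>m n + b \<cdot>\<^sub>m Y) * (a \<cdot>\<^sub>m 1\<^sub>m n + b \<cdot>\<^sub>m X)
      = ((a * a) \<cdot>\<^sub>m 1\<^sub>m n + (a * b) \<cdot>\<^sub>m Y + (b * a) \<cdot>\<^sub>m X + (b * b) \<cdot>\<^sub>m (X * Y)) * (a \<cdot>\<^sub>m 1\<^sub>m n + b \<cdot>\<^sub>m X)"
      by (simp only: mult_expand[OF X Y])
    also have "\<dots> = (a * a * a) \<cdot>\<^sub>m 1\<^sub>m n + (a * a * b + b * a * a + b * a * b * d + b * b * b) \<cdot>\<^sub>m X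
        + (a * a * b) \<cdot>\<^sub>m Y + (a * b * b) \<cdot>\<^sub>m (X * Y + Y * X)"
      using X Y XYX
      by (intro eq_matI) (auto simp: distribs XX algebra_simps simp del: index_mult_mat(1) assoc_mult_mat)
    finally show ?thesis unfolding b3 by (simp add: power2_eq_square power3_eq_cube mult.assoc)
  qed
  have "X * Y + Y * X = Y * X + X * Y" using X Y by (intro comm_add_mat) auto
  moreover have "a ^ 3 \<cdot>\<^sub>m 1\<^sub>m n + (a^2 * b) \<cdot>\<^sub>m X + (a^2 * b) \<cdot>\<^sub>m Y = a ^ 3 \<cdot>\<^sub>m 1\<^sub>m n + (a^2 * b) \<cdot>\<^sub>m Y + (a^2 * b) \<cdot>\<^sub>m X"
    using X Y by (intro eq_matI) (auto simp: algebra_simps)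
  ultimately show ?thesis unfolding P_def Q_def *[OF X Y XX XYX] *[OF Y X YY YXY] by simp
qed

text \<open>Turaev's enhanced Yang-Baxter operator for a switchback pair, over an arbitrary
  commutative ring. Truncation and cocycles enter only when the locale is interpreted and when
  \<epsilon> is shown to be a sign.\<close>

locale enhanced_pair =
  fixes \<beta> \<gamma> :: "'a::comm_ring_1 mat" and a b u v :: 'a
  assumes switchback: "switchback_pair \<beta> \<gamma>"
    and units: "a dvd 1" "b dvd 1" "u dvd 1" "v dvd 1"
    and rel: "a^2 + b^2 + loop_value \<beta> \<gamma> * a * b = 0"
    and uv: "u * v = loop_value \<beta> \<gamma> * a + b"
    and uv': "ring_inv u * v = loop_value \<beta> \<gamma> * ring_inv a + ring_inv b"
begin

abbreviation "a' \<equiv> ring_inv a"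
abbreviation "b' \<equiv> ring_inv b"
abbreviation "u' \<equiv> ring_inv u"
abbreviation "v' \<equiv> ring_inv v"
abbreviation "\<delta> \<equiv> loop_value \<beta> \<gamma>"
abbreviation "U \<equiv> \<gamma> * \<beta>"
abbreviation "R \<equiv> R_mat a b \<beta> \<gamma>"
abbreviation "\<nu> \<equiv> nu_mat \<beta> \<gamma>"

lemma inverses: "a * a' = 1" "b * b' = 1" "u * u' = 1" "v * v' = 1"
  using units by (simp_all add: ring_inv_right)

lemma carriers: "\<beta> \<in> carrier_mat 1 4" "\<gamma> \<in> carrier_mat 4 1" "U \<in> carrier_mat 4 4"
    "\<nu> \<in> carrier_mat 2 2" "R_mat p q \<beta> \<gamma> \<in> carrier_mat 4 4"
  using switchback by (auto simp: switchback_pair_def R_mat_def)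

lemma nu_dim [simp]: "dim_row \<nu> = 2" "dim_col \<nu> = 2"
  using carriers(4) by (blast dest: carrier_matD)+

lemma beta_gamma: "\<beta> * \<gamma> = \<delta> \<cdot>\<^sub>m 1\<^sub>m 1"
  using carriers by (intro eq_matI) (auto simp: loop_value_def)

lemma U_squared: "U * U = \<delta> \<cdot>\<^sub>m U"
proof -
  have "U * U = \<gamma> * (\<beta> * \<gamma>) * \<beta>"
    using carriers by (simp add: assoc_mult_mat[of _ 4 1 _ 4 _ 4] assoc_mult_mat[of _ 4 1 _ 1 _ 4]
        assoc_mult_mat[of _ 1 4 _ 1 _ 4])
  then show ?thesis using carriers
    by (simp add: beta_gamma mult_smult_distrib[of _ 4 1 _ 1] mult_smult_assoc_mat[of _ 4 1 _ 4])
qed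

text \<open>The coefficient of \<open>U\<close> in the product with the claimed inverse is
  \<open>a * b' + b * a' + \<delta>\<close>, which is the scalar relation multiplied by
  \<open>a' * b'\<close>.\<close>

lemma R_inverse: "mat_inv R = R_mat a' b' \<beta> \<gamma>"
  and R_inverse_mult: "R * mat_inv R = 1\<^sub>m 4" "mat_inv R * R = 1\<^sub>m 4"
proof -
  have "a' * b' * (a^2 + b^2 + \<delta> * a * b) = a * a' * (a * b') + b * b' * (b * a') + \<delta> * (a * a') * (b * b')"
    by (simp add: power2_eq_square algebra_simps)
  then have z: "a * b' + b * a' + \<delta> = 0" using rel by (simp add: inverses)
  have one: "R_mat p q \<beta> \<gamma> * R_mat p' q' \<beta> \<gamma> = 1\<^sub>m 4"
    if "p * p' = 1" "q * q' = 1" "p * q' + q * p' + \<delta> = 0" for p q p' q'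
  proof -
    have "R_mat p q \<beta> \<gamma> * R_mat p' q' \<beta> \<gamma> = (p * p') \<cdot>\<^sub>m 1\<^sub>m 4 + (p * q' + q * p' + \<delta> * (q * q')) \<cdot>\<^sub>m U"
      unfolding R_mat_def mult_expand[OF carriers(3,3)] U_squared
      using carriers by (intro eq_matI) (auto simp: algebra_simps simp del: index_mult_mat(1))
    then show ?thesis using that carriers(1,2) by (auto intro!: eq_matI simp del: index_mult_mat(1))
  qed
  have inv: "R * R_mat a' b' \<beta> \<gamma> = 1\<^sub>m 4" "R_mat a' b' \<beta> \<gamma> * R = 1\<^sub>m 4"
    using z inverses by (intro one; simp add: ac_simps)+
  show R': "mat_inv R = R_mat a' b' \<beta> \<gamma>"
    by (rule mat_inv_eqI[OF carriers(5,5) inv])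
  show "R * mat_inv R = 1\<^sub>m 4" "mat_inv R * R = 1\<^sub>m 4"
    unfolding R' by (rule inv)+
qed

text \<open>With \<nu> equal to \<open>C B^T\<close>, these are
  \<open>C \<nu>^T = C B C^T = C^T\<close> and \<open>B \<nu> = B C B^T = B^T\<close>: one copy of
  \<nu> transposes the pairing, so two copies restore it.\<close>

lemma nu_flip:
  assumes "i < 2" "j < 2"
  shows "(\<Sum>m<2. \<gamma> $$ (i * 2 + m, 0) * \<nu> $$ (j, m)) = \<gamma> $$ (j * 2 + i, 0)"
    and "(\<Sum>m<2. \<beta> $$ (0, i * 2 + m) * \<nu> $$ (m, j)) = \<beta> $$ (0, j * 2 + i)"
proof -
  let ?C = "\<lambda>i j. \<gamma> $$ (i * 2 + j, 0)" and ?B = "\<lambda>i j. \<beta> $$ (0, i * 2 + j)"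
  have "(\<Sum>m<2. ?C i m * \<nu> $$ (j, m)) = (\<Sum>m<2. \<Sum>k<2. ?C i m * (?C j k * ?B m k))"
    using assms carriers by (simp add: nu_mat_entry sum_distrib_left)
  also have "\<dots> = (\<Sum>k<2. ?C j k * (\<Sum>m<2. ?C i m * ?B m k))"
    by (subst sum.swap) (simp add: sum_distrib_left ac_simps)
  also have "\<dots> = (\<Sum>k<2. ?C j k * (if i = k then 1 else 0))"
    using switchback_pairD(2)[OF switchback assms(1)] by simp
  finally show "(\<Sum>m<2. ?C i m * \<nu> $$ (j, m)) = ?C j i" using assms by (auto simp: less_two_cases sum_lessThan_two)
  have "(\<Sum>m<2. ?B i m * \<nu> $$ (m, j)) = (\<Sum>m<2. \<Sum>k<2. ?B i m * (?C m k * ?B j k))"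
    using assms carriers by (simp add: nu_mat_entry sum_distrib_left)
  also have "\<dots> = (\<Sum>k<2. ?B j k * (\<Sum>m<2. ?B i m * ?C m k))"
    by (subst sum.swap) (simp add: sum_distrib_left ac_simps)
  also have "\<dots> = (\<Sum>k<2. ?B j k * (if i = k then 1 else 0))"
    using switchback_pairD(1)[OF switchback assms(1)] by simp
  finally show "(\<Sum>m<2. ?B i m * \<nu> $$ (m, j)) = ?B j i" using assms by (auto simp: less_two_cases sum_lessThan_two)
qed

lemma nu_gamma: "(\<nu> \<otimes>\<^sub>t \<nu>) * \<gamma> = \<gamma>"
proof (rule eq_matI)
  fix r c assume "r < dim_row \<gamma>" "c < dim_col \<gamma>"
  then have c: "c = 0" and r: "r < 2 * 2" using carriers by auto
  note r' = div_mod_less_mult[OF r]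
  have "((\<nu> \<otimes>\<^sub>t \<nu>) * \<gamma>) $$ (r div 2 * 2 + r mod 2, 0) =
      (\<Sum>k<2. \<nu> $$ (r div 2, k) * (\<Sum>l<2. \<nu> $$ (r mod 2, l) * \<gamma> $$ (k * 2 + l, 0)))"
    by (rule tensor_mult_column_entry[OF carriers(4,4,2) r'])
  also have "\<dots> = (\<Sum>k<2. \<gamma> $$ (r mod 2 * 2 + k, 0) * \<nu> $$ (r div 2, k))"
    using nu_flip(1)[OF _ r'(2)] by (intro sum.cong) (simp_all add: ac_simps)
  also have "\<dots> = \<gamma> $$ (r div 2 * 2 + r mod 2, 0)" by (rule nu_flip(1)[OF r'(2,1)])
  finally show "((\<nu> \<otimes>\<^sub>t \<nu>) * \<gamma>) $$ (r, c) = \<gamma> $$ (r, c)" using c by simp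
qed (use carriers in auto)

lemma beta_nu: "\<beta> * (\<nu> \<otimes>\<^sub>t \<nu>) = \<beta>"
proof (rule eq_matI)
  fix r c assume "r < dim_row \<beta>" "c < dim_col \<beta>"
  then have r: "r = 0" and c: "c < 2 * 2" using carriers by auto
  note c' = div_mod_less_mult[OF c]
  have "(\<beta> * (\<nu> \<otimes>\<^sub>t \<nu>)) $$ (0, c div 2 * 2 + c mod 2) =
      (\<Sum>k<2. (\<Sum>l<2. \<beta> $$ (0, k * 2 + l) * \<nu> $$ (l, c mod 2)) * \<nu> $$ (k, c div 2))"
    by (rule row_mult_tensor_entry[OF carriers(4,4,1) c'])
  also have "\<dots> = (\<Sum>k<2. \<beta> $$ (0, c mod 2 * 2 + k) * \<nu> $$ (k, c div 2))"
    using nu_flip(2)[OF _ c'(2)] by (intro sum.cong) simp_all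
  also have "\<dots> = \<beta> $$ (0, c div 2 * 2 + c mod 2)" by (rule nu_flip(2)[OF c'(2,1)])
  finally show "(\<beta> * (\<nu> \<otimes>\<^sub>t \<nu>)) $$ (r, c) = \<beta> $$ (r, c)" using r by simp
qed (use carriers in auto)

lemma nu_R_commute: "(\<nu> \<otimes>\<^sub>t \<nu>) * R_mat p q \<beta> \<gamma> = R_mat p q \<beta> \<gamma> * (\<nu> \<otimes>\<^sub>t \<nu>)"
proof -
  have nn: "\<nu> \<otimes>\<^sub>t \<nu> \<in> carrier_mat 4 4" using tensor_mat_carrier[OF carriers(4,4)] by simp
  have "(\<nu> \<otimes>\<^sub>t \<nu>) * U = U"
    using assoc_mult_mat[OF nn carriers(2,1)] by (simp add: nu_gamma)
  moreover have "U * (\<nu> \<otimes>\<^sub>t \<nu>) = U"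
    using assoc_mult_mat[OF carriers(2,1) nn] by (simp add: beta_nu)
  ultimately show ?thesis unfolding R_mat_def using nn carriers(3)
    by (simp add: add_mult_distrib_mat[of _ 4 4 _ _ 4] mult_add_distrib_mat[of _ 4 4 _ 4]
      mult_smult_distrib[of _ 4 4 _ 4] mult_smult_assoc_mat[of _ 4 4 _ 4] right_mult_one_mat[of _ 4 4] left_mult_one_mat[of _ 4 4])
qed

lemma nu_trace: "mat_tr \<nu> = \<delta>"
  using carriers
  by (simp add: mat_tr_def nu_mat_entry loop_value_def scalar_prod_def atLeastLessThan_enum sum_lessThan_two
      algebra_simps flip: numeral_2_eq_2)

text \<open>Closing the idle strand gives the trace of \<nu>, hence \<delta>; in the
  \<open>U\<close> term \<nu> flips the cup, and what remains is a zigzag that straightens to the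
  identity. Free \<open>p\<close> and \<open>q\<close> cover \<open>R\<close> and its inverse at
  once, with scalars \<open>u * v\<close> and \<open>u' * v\<close>.\<close>

lemma nu_partial_tr: "partial_tr ((1\<^sub>m 2 \<otimes>\<^sub>t \<nu>) * R_mat p q \<beta> \<gamma>) = (p * \<delta> + q) \<cdot>\<^sub>m 1\<^sub>m 2"
proof (rule eq_matI)
  fix i j assume "i < dim_row ((p * \<delta> + q) \<cdot>\<^sub>m 1\<^sub>m 2)" "j < dim_col ((p * \<delta> + q) \<cdot>\<^sub>m 1\<^sub>m 2)"
  then have ij: "i < 2" "j < 2" by auto
  let ?N = "1\<^sub>m 2 \<otimes>\<^sub>t \<nu>"
  have N: "?N \<in> carrier_mat 4 4" using tensor_mat_carrier[OF one_carrier_mat[of 2] carriers(4)] by simp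
  have "?N * R_mat p q \<beta> \<gamma> = p \<cdot>\<^sub>m ?N + q \<cdot>\<^sub>m (?N * U)"
    unfolding R_mat_def using N carriers(3)
    by (simp add: mult_add_distrib_mat[of _ 4 4 _ 4] mult_smult_distrib[of _ 4 4 _ 4] right_mult_one_mat[of _ 4 4])
  also have "?N * U = (?N * \<gamma>) * \<beta>"
    by (rule assoc_mult_mat[OF N carriers(2,1), symmetric])
  finally have split: "?N * R_mat p q \<beta> \<gamma> = p \<cdot>\<^sub>m ?N + q \<cdot>\<^sub>m ((?N * \<gamma>) * \<beta>)" .
  have entry: "(?N * R_mat p q \<beta> \<gamma>) $$ (i * 2 + k, j * 2 + k)
      = p * ((if i = j then 1 else 0) * \<nu> $$ (k, k)) + q * (\<gamma> $$ (k * 2 + i, 0) * \<beta> $$ (0, j * 2 + k))"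
    if k: "k < 2" for k
  proof -
    have lt: "i * 2 + k < 4" "j * 2 + k < 4" using ij k by auto
    have "(?N * \<gamma>) $$ (i * 2 + k, 0) = (\<Sum>m<2. 1\<^sub>m 2 $$ (i, m) * (\<Sum>l<2. \<nu> $$ (k, l) * \<gamma> $$ (m * 2 + l, 0)))"
      by (rule tensor_mult_column_entry[OF _ carriers(4,2) ij(1) k]) simp
    also have "\<dots> = (\<Sum>l<2. \<gamma> $$ (i * 2 + l, 0) * \<nu> $$ (k, l))"
      using ij by (auto simp: less_two_cases sum_lessThan_two ac_simps)
    also have "\<dots> = \<gamma> $$ (k * 2 + i, 0)" by (rule nu_flip(1)[OF ij(1) k])
    finally have g: "(?N * \<gamma>) $$ (i * 2 + k, 0) = \<gamma> $$ (k * 2 + i, 0)" .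
    have "((?N * \<gamma>) * \<beta>) $$ (i * 2 + k, j * 2 + k) = (?N * \<gamma>) $$ (i * 2 + k, 0) * \<beta> $$ (0, j * 2 + k)"
      using lt N carriers(1,2) by (simp add: scalar_prod_def sum_distrib_right mult.assoc)
    then show ?thesis unfolding split using lt N carriers(1,2) ij k g
      by (simp add: tensor_mat_index del: index_mult_mat(1))
  qed
  have "partial_tr (?N * R_mat p q \<beta> \<gamma>) $$ (i, j)
      = (\<Sum>k<2. (?N * R_mat p q \<beta> \<gamma>) $$ (i * 2 + k, j * 2 + k))"
    using ij carrier_matD[OF carriers(5)] by (simp add: partial_tr_def del: index_mult_mat(1))
  also have "\<dots> = p * ((if i = j then 1 else 0) * mat_tr \<nu>)
      + q * (\<Sum>k<2. \<beta> $$ (0, j * 2 + k) * \<gamma> $$ (k * 2 + i, 0))"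
    unfolding sum_lessThan_two using entry[of 0] entry[of 1]
    by (simp add: sum_lessThan_two mat_tr_def algebra_simps del: index_mult_mat(1))
  also have "\<dots> = ((p * \<delta> + q) \<cdot>\<^sub>m 1\<^sub>m 2) $$ (i, j)"
    using switchback_pairD(1)[OF switchback ij(2,1)] ij by (auto simp: nu_trace)
  finally show "partial_tr (?N * R_mat p q \<beta> \<gamma>) $$ (i, j) = ((p * \<delta> + q) \<cdot>\<^sub>m 1\<^sub>m 2) $$ (i, j)" .
qed (use carrier_matD[OF carriers(5)] in \<open>auto simp: partial_tr_def\<close>)

lemma R_yang_baxter:
  "(R \<otimes>\<^sub>t 1\<^sub>m 2) * (1\<^sub>m 2 \<otimes>\<^sub>t R) * (R \<otimes>\<^sub>t 1\<^sub>m 2) = (1\<^sub>m 2 \<otimes>\<^sub>t R) * (R \<otimes>\<^sub>t 1\<^sub>m 2) * (1\<^sub>m 2 \<otimes>\<^sub>t R)"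
proof -
  let ?X = "U \<otimes>\<^sub>t 1\<^sub>m 2" and ?Y = "1\<^sub>m 2 \<otimes>\<^sub>t U"
  let ?g = "\<gamma> \<otimes>\<^sub>t 1\<^sub>m 2" and ?b = "\<beta> \<otimes>\<^sub>t 1\<^sub>m 2" and ?g' = "1\<^sub>m 2 \<otimes>\<^sub>t \<gamma>" and ?b' = "1\<^sub>m 2 \<otimes>\<^sub>t \<beta>"
  have c: "?g \<in> carrier_mat 8 2" "?b \<in> carrier_mat 2 8" "?g' \<in> carrier_mat 8 2" "?b' \<in> carrier_mat 2 8"
    using tensor_mat_carrier[OF carriers(2) one_carrier_mat[of 2]]
      tensor_mat_carrier[OF carriers(1) one_carrier_mat[of 2]]
      tensor_mat_carrier[OF one_carrier_mat[of 2] carriers(2)]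
      tensor_mat_carrier[OF one_carrier_mat[of 2] carriers(1)] by simp_all
  have dims: "dim_row \<beta> = 1" "dim_col \<beta> = 4" "dim_row \<gamma> = 4" "dim_col \<gamma> = 1" using carriers by auto
  have X: "?X = ?g * ?b" and Y: "?Y = ?g' * ?b'" by (subst tensor_mat_mult; simp add: dims)+
  have XC: "?X \<in> carrier_mat 8 8" and YC: "?Y \<in> carrier_mat 8 8" unfolding X Y using c by auto
  have sb: "?b * ?g' = 1\<^sub>m 2" "?b' * ?g = 1\<^sub>m 2"
    using switchback by (simp_all add: switchback_pair_def)
  \<comment> \<open>\<open>U\<close> factors through \<open>V\<close> after adding a strand, so the
    inner products \<open>B * G'\<close> and \<open>B' * G\<close> are the two zigzags; both orders
    of the Temperley-Lieb relation are instances.\<close>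
  have sandwich: "(G * B) * (G' * B') * (G * B) = G * B"
    if "B * G' = 1\<^sub>m 2" "B' * G = 1\<^sub>m 2" "G \<in> carrier_mat 8 2" "B \<in> carrier_mat 2 8"
      "G' \<in> carrier_mat 8 2" "B' \<in> carrier_mat 2 8" for G B G' B' :: "'a mat"
  proof -
    have "(G * B) * (G' * B') * (G * B) = G * ((B * G') * ((B' * G) * B))"
      using that(3-) by (simp add: assoc_mult_mat[of _ 8 2 _ 8 _ 8] assoc_mult_mat[of _ 8 8 _ 2 _ 8]
        assoc_mult_mat[of _ 2 8 _ 2 _ 8] assoc_mult_mat[of _ 8 8 _ 8 _ 8] assoc_mult_mat[of _ 2 8 _ 8 _ 8]
        mult_carrier_mat[of _ 2 8 _ 8] mult_carrier_mat[of _ 8 2 _ 8] mult_carrier_mat[of _ 2 8 _ 2]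
        assoc_mult_mat[of _ 2 2 _ 8 _ 8])
    then show ?thesis using that by simp
  qed
  have "?X * ?X = (U * U) \<otimes>\<^sub>t 1\<^sub>m 2" "?Y * ?Y = 1\<^sub>m 2 \<otimes>\<^sub>t (U * U)"
    by (subst tensor_mat_mult; simp add: dims)+
  then have sq: "?X * ?X = \<delta> \<cdot>\<^sub>m ?X" "?Y * ?Y = \<delta> \<cdot>\<^sub>m ?Y"
    by (simp_all add: U_squared tensor_mat_smult_left tensor_mat_smult_right)
  have "R \<otimes>\<^sub>t 1\<^sub>m 2 = a \<cdot>\<^sub>m 1\<^sub>m 8 + b \<cdot>\<^sub>m ?X" "1\<^sub>m 2 \<otimes>\<^sub>t R = a \<cdot>\<^sub>m 1\<^sub>m 8 + b \<cdot>\<^sub>m ?Y"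
    by (simp_all add: R_mat_def tensor_mat_add_left tensor_mat_add_right tensor_mat_smult_left
        tensor_mat_smult_right dims)
  then show ?thesis
    using yang_baxter[OF XC YC sq _ _ rel] sandwich[OF sb c] sandwich[OF sb(2,1) c(3,4,1,2)] unfolding X Y
    by simp
qed

end


section \<open>The braid group representation\<close>

text \<open>Counting the idle strands on either side, instead of a position and a total, leaves the
  width of \<open>M\<close> open: two strands for a crossing, three for the braid relation.\<close>

definition strand_mat :: "nat \<Rightarrow> nat \<Rightarrow> 'a::comm_ring_1 mat \<Rightarrow> 'a mat" where
  "strand_mat i k M = 1\<^sub>m (2 ^ i) \<otimes>\<^sub>t M \<otimes>\<^sub>t 1\<^sub>m (2 ^ k)"

lemma strand_mat_carrier:
  "M \<in> carrier_mat (2 ^ m) (2 ^ m) \<Longrightarrow> strand_mat i k M \<in> carrier_mat (2 ^ (i + m + k)) (2 ^ (i + m + k))"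
  by (simp add: strand_mat_def power_add)

lemma strand_mat_mult:
  assumes "M \<in> carrier_mat m m" "N \<in> carrier_mat m m"
  shows "strand_mat i k M * strand_mat i k N = strand_mat i k (M * N)"
  using assms by (auto simp: strand_mat_def tensor_mat_mult)

lemma strand_mat_one: "strand_mat i k (1\<^sub>m (2 ^ m)) = 1\<^sub>m (2 ^ (i + m + k))"
  by (simp add: strand_mat_def power_add)

lemma strand_mat_linear:
  assumes "M \<in> carrier_mat m m" "N \<in> carrier_mat m m"
  shows "strand_mat i k (M + N) = strand_mat i k M + strand_mat i k N"
    "strand_mat i k (p \<cdot>\<^sub>m M) = p \<cdot>\<^sub>m strand_mat i k M"
  using assms by (auto simp: strand_mat_def tensor_mat_add_left tensor_mat_add_right
      tensor_mat_smult_left tensor_mat_smult_right)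

text \<open>Adjacent crossings are hereby seen inside the same three-strand window, where the
  Yang-Baxter equation lives.\<close>

lemma strand_mat_shift:
  "strand_mat i k (1\<^sub>m (2 ^ m) \<otimes>\<^sub>t M) = strand_mat (i + m) k M"
  "strand_mat i k (M \<otimes>\<^sub>t 1\<^sub>m (2 ^ m)) = strand_mat i (m + k) M"
  by (simp_all add: strand_mat_def power_add tensor_mat_assoc flip: tensor_mat_one)

lemma crossing_mat_eq_strand_mat:
  "crossing_mat S n c = strand_mat (strand c) (n - 2 - strand c) (case c of Pos _ \<Rightarrow> S | Neg _ \<Rightarrow> mat_inv S)"
  by (simp add: crossing_mat_def strand_mat_def)

lemma four_eq: "(4::nat) = 2 ^ 2" by simp

context
  fixes S :: "'a::comm_ring_1 mat"
  assumes S: "S \<in> carrier_mat 4 4" "mat_inv S \<in> carrier_mat 4 4"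
begin

lemma crossing_case_carrier: "(case c of Pos _ \<Rightarrow> S | Neg _ \<Rightarrow> mat_inv S) \<in> carrier_mat 4 4"
  using S by (simp split: crossing.split)

lemma crossing_mat_carrier:
  assumes "Suc (strand c) < n"
  shows "crossing_mat S n c \<in> carrier_mat (2 ^ n) (2 ^ n)"
proof -
  have "strand c + 2 + (n - 2 - strand c) = n" using assms by simp
  then show ?thesis unfolding crossing_mat_eq_strand_mat
    using strand_mat_carrier[of _ 2 "strand c" "n - 2 - strand c", OF crossing_case_carrier[unfolded four_eq]]
    by (simp only:)
qed

lemma braid_rep_carrier:
  "braid_word n w \<Longrightarrow> braid_rep S n w \<in> carrier_mat (2 ^ n) (2 ^ n)"
  by (induction w) (auto simp: braid_rep_def intro: mult_carrier_mat crossing_mat_carrier)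

lemma braid_rep_append:
  "braid_word n p \<Longrightarrow> braid_word n q \<Longrightarrow> braid_rep S n (p @ q) = braid_rep S n p * braid_rep S n q"
proof (induction p)
  case Nil
  then show ?case using braid_rep_carrier[of n q] by (simp add: braid_rep_def)
next
  case (Cons c p)
  then have "braid_rep S n (c # p @ q) = crossing_mat S n c * (braid_rep S n p * braid_rep S n q)"
    by (simp add: braid_rep_def)
  also have "\<dots> = crossing_mat S n c * braid_rep S n p * braid_rep S n q"
    using Cons.prems crossing_mat_carrier[of c n] braid_rep_carrier
    by (intro assoc_mult_mat[symmetric]) auto
  finally show ?case by (simp add: braid_rep_def)
qed

lemma braid_rep_Cons: "braid_rep S n (c # w) = crossing_mat S n c * braid_rep S n w"
  by (simp add: braid_rep_def)

lemma braid_rep_single: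
  "Suc (strand c) < n \<Longrightarrow> braid_rep S n [c] = crossing_mat S n c"
  using crossing_mat_carrier[of c n] by (simp add: braid_rep_def)

lemma braid_rep_Suc:
  "braid_word n w \<Longrightarrow> braid_rep S (Suc n) w = braid_rep S n w \<otimes>\<^sub>t 1\<^sub>m 2"
proof (induction w)
  case Nil
  then show ?case by (simp add: braid_rep_def mult.commute)
next
  case (Cons c w)
  then have c: "Suc (strand c) < n" and w: "braid_word n w" by simp_all
  then have "Suc n - 2 - strand c = (n - 2 - strand c) + 1" by simp
  then have "crossing_mat S (Suc n) c = crossing_mat S n c \<otimes>\<^sub>t 1\<^sub>m 2"
    by (simp add: crossing_mat_eq_strand_mat strand_mat_def tensor_mat_assoc mult.commute[of 2])
  then show ?case
    using Cons.IH[OF w] crossing_mat_carrier[OF c] braid_rep_carrier[OF w]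
    by (auto simp: braid_rep_Cons tensor_mat_mult)
qed

end

section \<open>The braid trace under the Markov moves\<close>

context enhanced_pair
begin

abbreviation "F \<equiv> DB R \<nu> u v"
abbreviation "N n \<equiv> tensor_pow \<nu> n"

lemma R_carriers: "R \<in> carrier_mat 4 4" "mat_inv R \<in> carrier_mat 4 4"
  using carriers by (simp_all add: R_inverse)

lemmas rep_carrier = braid_rep_carrier[OF R_carriers]
lemmas rep_append = braid_rep_append[OF R_carriers]
lemmas rep_Cons = braid_rep_Cons[OF R_carriers]

lemma nu_pow_carrier: "N n \<in> carrier_mat (2 ^ n) (2 ^ n)"
  using carriers by simp

lemma nu_pow_dim [simp]: "dim_row (N n) = 2 ^ n" "dim_col (N n) = 2 ^ n"
  using nu_pow_carrier by (blast dest: carrier_matD)+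

lemma nu_crossing_commute:
  assumes "Suc (strand c) < n"
  shows "N n * crossing_mat R n c = crossing_mat R n c * N n"
proof -
  let ?S = "case c of Pos _ \<Rightarrow> R | Neg _ \<Rightarrow> mat_inv R"
  let ?i = "strand c" and ?k = "n - 2 - strand c"
  have n: "n = ?i + (2 + ?k)" using assms by simp
  have "N (?i + (2 + ?k)) = N ?i \<otimes>\<^sub>t (\<nu> \<otimes>\<^sub>t \<nu>) \<otimes>\<^sub>t N ?k"
    unfolding tensor_pow_add by (simp add: tensor_mat_assoc numeral_2_eq_2)
  then have N: "N n = N ?i \<otimes>\<^sub>t (\<nu> \<otimes>\<^sub>t \<nu>) \<otimes>\<^sub>t N ?k"
    by (rule HOL.trans[OF arg_cong[OF n, of N]])
  have "?S \<in> carrier_mat 4 4" by (rule crossing_case_carrier[OF R_carriers])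
  moreover have "\<nu> \<otimes>\<^sub>t \<nu> \<in> carrier_mat 4 4" using tensor_mat_carrier[OF carriers(4,4)] by simp
  moreover have "(\<nu> \<otimes>\<^sub>t \<nu>) * ?S = ?S * (\<nu> \<otimes>\<^sub>t \<nu>)"
    by (cases c) (simp_all add: R_inverse nu_R_commute)
  ultimately show ?thesis
    unfolding crossing_mat_eq_strand_mat strand_mat_def N
    using nu_pow_carrier[of ?i] nu_pow_carrier[of ?k]
    by (auto simp: tensor_mat_mult)
qed

lemma nu_rep_commute:
  "braid_word n w \<Longrightarrow> N n * braid_rep R n w = braid_rep R n w * N n"
proof (induction w)
  case Nil
  then show ?case using nu_pow_carrier[of n] by (simp add: braid_rep_def)
next
  case (Cons c w)
  then have c: "Suc (strand c) < n" and w: "braid_word n w" by simp_all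
  note C = crossing_mat_carrier[OF R_carriers c] and W = rep_carrier[OF w] and P = nu_pow_carrier[of n]
  have "N n * (crossing_mat R n c * braid_rep R n w) = crossing_mat R n c * (N n * braid_rep R n w)"
    by (simp only: assoc_mult_mat[OF P C W, symmetric] assoc_mult_mat[OF C P W, symmetric] nu_crossing_commute[OF c])
  also have "\<dots> = (crossing_mat R n c * braid_rep R n w) * N n"
    by (simp only: assoc_mult_mat[OF C W P] Cons.IH[OF w])
  finally show ?case by (simp add: rep_Cons)
qed

text \<open>Cyclicity of the trace brings one braid in front of the power of \<nu>, and commutation
  carries it past.\<close>

lemma trace_cyclic:
  assumes p: "braid_word n p" and q: "braid_word n q"
  shows "mat_tr (N n * braid_rep R n (p @ q)) = mat_tr (N n * braid_rep R n (q @ p))"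
proof -
  note P = rep_carrier[OF p] and Q = rep_carrier[OF q] and V = nu_pow_carrier[of n]
  have "mat_tr (N n * (braid_rep R n p * braid_rep R n q)) = mat_tr ((N n * braid_rep R n p) * braid_rep R n q)"
    by (simp only: assoc_mult_mat[OF V P Q])
  also have "\<dots> = mat_tr (braid_rep R n q * (N n * braid_rep R n p))"
    by (rule mat_tr_mult_commute[OF mult_carrier_mat[OF V P] Q])
  also have "braid_rep R n q * (N n * braid_rep R n p) = N n * (braid_rep R n q * braid_rep R n p)"
    by (simp only: assoc_mult_mat[OF Q V P, symmetric] assoc_mult_mat[OF V Q P, symmetric] nu_rep_commute[OF q])
  finally show ?thesis using p q by (simp add: rep_append)
qed

lemma trace_stabilise:
  assumes w: "braid_word n w" and c: "strand c = n - 1"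
  shows "mat_tr (N (Suc n) * braid_rep R (Suc n) (w @ [c])) =
    (case c of Pos _ \<Rightarrow> u * v | Neg _ \<Rightarrow> u' * v) * mat_tr (N n * braid_rep R n w)"
proof -
  \<comment> \<open>A braid word has at least one strand; \<open>k\<close> counts the strands that
    the new crossing does not touch.\<close>
  obtain k where n: "n = Suc k" using w by (cases n) (auto simp: braid_word_def)
  let ?S = "case c of Pos _ \<Rightarrow> R | Neg _ \<Rightarrow> mat_inv R"
  have c': "Suc (strand c) < Suc n" using c n by simp
  have w': "braid_word (Suc n) w" using w by (auto simp: braid_word_def)
  have pow: "N (Suc n) = N n \<otimes>\<^sub>t \<nu>"
    using tensor_pow_add[of \<nu> n 1] by simp
  have "crossing_mat R (Suc n) c = 1\<^sub>m (2 ^ k) \<otimes>\<^sub>t ?S"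
    using c n by (simp add: crossing_mat_eq_strand_mat strand_mat_def)
  then have rep: "braid_rep R (Suc n) (w @ [c]) = (braid_rep R n w \<otimes>\<^sub>t 1\<^sub>m 2) * (1\<^sub>m (2 ^ k) \<otimes>\<^sub>t ?S)"
    using c' w' w by (simp add: rep_append braid_rep_single[OF R_carriers] braid_rep_Suc[OF R_carriers] braid_word_def)
  note W = rep_carrier[OF w] and V = nu_pow_carrier[of n]
  have W2: "braid_rep R n w \<otimes>\<^sub>t 1\<^sub>m 2 \<in> carrier_mat (2 ^ n * 2) (2 ^ n * 2)" using W by simp
  have V2: "N n \<otimes>\<^sub>t \<nu> \<in> carrier_mat (2 ^ n * 2) (2 ^ n * 2)" using V carriers(4) by simp
  have S: "?S \<in> carrier_mat 4 4" by (rule crossing_case_carrier[OF R_carriers])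
  have S2: "1\<^sub>m (2 ^ k) \<otimes>\<^sub>t ?S \<in> carrier_mat (2 ^ n * 2) (2 ^ n * 2)"
    using tensor_mat_carrier[OF one_carrier_mat[of "2 ^ k"] S] n by (simp add: ac_simps)
  have "N (Suc n) * braid_rep R (Suc n) (w @ [c])
      = ((N n \<otimes>\<^sub>t \<nu>) * (braid_rep R n w \<otimes>\<^sub>t 1\<^sub>m 2)) * (1\<^sub>m (2 ^ k) \<otimes>\<^sub>t ?S)"
    unfolding pow rep by (rule assoc_mult_mat[OF V2 W2 S2, symmetric])
  also have "(N n \<otimes>\<^sub>t \<nu>) * (braid_rep R n w \<otimes>\<^sub>t 1\<^sub>m 2) = (N n * braid_rep R n w) \<otimes>\<^sub>t \<nu>"
    using V W carriers(4) by (auto simp: tensor_mat_mult)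
  finally have eq: "N (Suc n) * braid_rep R (Suc n) (w @ [c])
      = ((N n * braid_rep R n w) \<otimes>\<^sub>t \<nu>) * (1\<^sub>m (2 ^ k) \<otimes>\<^sub>t ?S)" .
  have X: "N n * braid_rep R n w \<in> carrier_mat (2 ^ k * 2) (2 ^ k * 2)"
    using mult_carrier_mat[OF V W] n by (simp add: ac_simps)
  have "partial_tr ((1\<^sub>m 2 \<otimes>\<^sub>t \<nu>) * ?S) = (case c of Pos _ \<Rightarrow> u * v | Neg _ \<Rightarrow> u' * v) \<cdot>\<^sub>m 1\<^sub>m 2"
    using uv uv' by (cases c) (simp_all add: R_inverse nu_partial_tr mult.commute[of _ \<delta>])
  then show ?thesis unfolding eq by (rule mat_tr_stabilise[OF X carriers(4) S])
qed

lemma writhe_append [simp]: "writhe (p @ q) = writhe p + writhe q"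
  by (simp add: writhe_def)

lemma writhe_simps [simp]: "writhe [] = 0" "writhe (Pos i # w) = 1 + writhe w" "writhe (Neg i # w) = - 1 + writhe w"
  by (simp_all add: writhe_def)

lemma u_power: "unit_power u (i + j) = unit_power u i * unit_power u j"
  and v_power: "unit_power v (i + j) = unit_power v i * unit_power v j"
  using units by (simp_all add: unit_power_add)

lemma DB_context:
  assumes "braid_word n p" "braid_word n q" "braid_word n x" "braid_word n y"
    and "writhe x = writhe y" "braid_rep R n x = braid_rep R n y"
  shows "F n (p @ x @ q) = F n (p @ y @ q)"
  using assms by (simp add: DB_def rep_append)

text \<open>The trace gains \<open>u * v\<close> or \<open>u' * v\<close>, while the change of
  writhe and strand number contributes exactly the inverse; this is the purpose of the normalisation
  in \<open>DB\<close>.\<close>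

lemma DB_stabilise:
  assumes "braid_word n w"
  shows "F (Suc n) (w @ [Pos (n - 1)]) = F n w" "F (Suc n) (w @ [Neg (n - 1)]) = F n w"
proof -
  have v: "unit_power v (- int (Suc n)) = unit_power v (- int n) * v'"
    using v_power[of "- int n" "- 1"] by (simp add: ac_simps)
  have "unit_power u (- 1 - writhe w) = u' * unit_power u (- writhe w)"
    using u_power[of "- 1" "- writhe w"] by simp
  then have "F (Suc n) (w @ [Pos (n - 1)]) = (u * u') * (v * v') * F n w"
    using trace_stabilise[OF assms, of "Pos (n - 1)"] v by (simp add: DB_def ac_simps)
  then show "F (Suc n) (w @ [Pos (n - 1)]) = F n w" by (simp add: inverses)
  have "unit_power u (1 - writhe w) = u * unit_power u (- writhe w)"
    using u_power[of 1 "- writhe w"] by simp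
  then have "F (Suc n) (w @ [Neg (n - 1)]) = (u * u') * (v * v') * F n w"
    using trace_stabilise[OF assms, of "Neg (n - 1)"] v by (simp add: DB_def ac_simps)
  then show "F (Suc n) (w @ [Neg (n - 1)]) = F n w" by (simp add: inverses)
qed

lemma crossing_mat_Pos_Neg:
  assumes "i + 2 + k = n"
  shows "crossing_mat R n (Pos i) = strand_mat i k R" "crossing_mat R n (Neg i) = strand_mat i k (mat_inv R)"
  using assms by (auto simp: crossing_mat_eq_strand_mat)

lemma crossing_cancel:
  assumes "Suc i < n"
  shows "braid_rep R n [Pos i, Neg i] = braid_rep R n []" "braid_rep R n [Neg i, Pos i] = braid_rep R n []"
proof -
  define k where "k = n - 2 - i"
  have n: "i + 2 + k = n" using assms by (simp add: k_def)
  have "strand_mat i k (1\<^sub>m 4 :: 'a mat) = 1\<^sub>m (2 ^ n)"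
    using strand_mat_one[of i k 2] by (simp only: n four_eq)
  then show "braid_rep R n [Pos i, Neg i] = braid_rep R n []" "braid_rep R n [Neg i, Pos i] = braid_rep R n []"
    using crossing_mat_carrier[OF R_carriers, of "Pos i" n] crossing_mat_carrier[OF R_carriers, of "Neg i" n] assms
    by (simp_all add: braid_rep_def crossing_mat_Pos_Neg[OF n] strand_mat_mult[OF R_carriers]
        strand_mat_mult[OF R_carriers(2,1)] R_inverse_mult right_mult_one_mat)
qed

lemma crossing_far:
  assumes "Suc i < j" "Suc j < n"
  shows "braid_rep R n [Pos i, Pos j] = braid_rep R n [Pos j, Pos i]"
proof -
  define m where "m = j - i - 2"
  define k where "k = n - 2 - j"
  have j: "j = i + 2 + m" and n: "n = i + 2 + m + 2 + k" using assms by (simp_all add: m_def k_def)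
  let ?M = "1\<^sub>m (2 ^ i) \<otimes>\<^sub>t R" and ?N = "1\<^sub>m (2 ^ m) \<otimes>\<^sub>t R \<otimes>\<^sub>t 1\<^sub>m (2 ^ k)"
  have M: "?M \<in> carrier_mat (2 ^ (i + 2)) (2 ^ (i + 2))"
    using tensor_mat_carrier[OF one_carrier_mat[of "2 ^ i"] R_carriers(1)] by (simp add: power_add mult.commute[of 4])
  have N: "?N \<in> carrier_mat (2 ^ (m + 2 + k)) (2 ^ (m + 2 + k))"
    using strand_mat_carrier[of R 2 m k] R_carriers(1) by (simp add: strand_mat_def)
  have "crossing_mat R n (Pos i) = ?M \<otimes>\<^sub>t 1\<^sub>m (2 ^ (m + 2 + k))"
    unfolding crossing_mat_eq_strand_mat strand_mat_def using n by simp
  moreover have "crossing_mat R n (Pos j) = 1\<^sub>m (2 ^ (i + 2)) \<otimes>\<^sub>t ?N"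
    unfolding crossing_mat_eq_strand_mat strand_mat_def using n j
    by (simp add: power_add tensor_mat_assoc flip: tensor_mat_one)
  ultimately have "crossing_mat R n (Pos i) * crossing_mat R n (Pos j) = crossing_mat R n (Pos j) * crossing_mat R n (Pos i)"
    using tensor_mat_interchange[OF M N] by simp
  then show ?thesis
    using crossing_mat_carrier[OF R_carriers, of "Pos i" n] crossing_mat_carrier[OF R_carriers, of "Pos j" n] assms
    by (simp add: braid_rep_def right_mult_one_mat)
qed

lemma crossing_braid:
  assumes "Suc (Suc i) < n"
  shows "braid_rep R n [Pos i, Pos (Suc i), Pos i] = braid_rep R n [Pos (Suc i), Pos i, Pos (Suc i)]"
proof -
  define k where "k = n - 3 - i"
  have n: "n = i + 3 + k" using assms by (simp add: k_def)
  let ?C = "crossing_mat R n (Pos i)" and ?D = "crossing_mat R n (Pos (Suc i))"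
  let ?R1 = "R \<otimes>\<^sub>t 1\<^sub>m 2" and ?R2 = "1\<^sub>m 2 \<otimes>\<^sub>t R"
  have R12: "?R1 \<in> carrier_mat 8 8" "?R2 \<in> carrier_mat 8 8"
    using tensor_mat_carrier[OF R_carriers(1) one_carrier_mat[of 2]]
      tensor_mat_carrier[OF one_carrier_mat[of 2] R_carriers(1)] by simp_all
  have C: "?C = strand_mat i k ?R1" and D: "?D = strand_mat i k ?R2"
    using strand_mat_shift(1)[of i k 1 R] strand_mat_shift(2)[of i k R 1] n
    by (simp_all add: crossing_mat_eq_strand_mat)
  have cd: "?C \<in> carrier_mat (2 ^ n) (2 ^ n)" "?D \<in> carrier_mat (2 ^ n) (2 ^ n)"
    using crossing_mat_carrier[OF R_carriers] assms by simp_all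
  have "?C * ?D * ?C = ?D * ?C * ?D"
    unfolding C D
    by (simp add: strand_mat_mult[OF R12] strand_mat_mult[OF R12(2,1)]
        strand_mat_mult[OF mult_carrier_mat[OF R12] R12(1)] strand_mat_mult[OF mult_carrier_mat[OF R12(2,1)] R12(2)]
        R_yang_baxter)
  then have "?C * (?D * ?C) = ?D * (?C * ?D)" by (simp only: assoc_mult_mat[OF cd cd(1)] assoc_mult_mat[OF cd(2,1) cd(2)])
  then show ?thesis using cd by (simp add: braid_rep_def right_mult_one_mat)
qed

lemma link_invariant_DB: "link_invariant F"
proof -
  have "F m w = F n w'" if "same_closure m w n w'" for m w n w'
    using that
  proof (induction rule: same_closure.induct)
    case (cancel_Pos n p i q)
    then show ?case using DB_context[of n p q "[Pos i, Neg i]" "[]"] crossing_cancel(1)[of i n]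
      by (auto simp: braid_word_def)
  next
    case (cancel_Neg n p i q)
    then show ?case using DB_context[of n p q "[Neg i, Pos i]" "[]"] crossing_cancel(2)[of i n]
      by (auto simp: braid_word_def)
  next
    case (far i j n p q)
    then show ?case using DB_context[of n p q "[Pos i, Pos j]" "[Pos j, Pos i]"] crossing_far[of i j n]
      by (auto simp: braid_word_def)
  next
    case (braid n p i q)
    then show ?case
      using DB_context[of n p q "[Pos i, Pos (Suc i), Pos i]" "[Pos (Suc i), Pos i, Pos (Suc i)]"]
        crossing_braid[of i n]
      by (auto simp: braid_word_def)
  next
    case (cyclic n p q)
    then show ?case using trace_cyclic[of n p q] by (simp add: DB_def add.commute)
  next
    case (stabilise_Pos n w)
    then show ?case by (simp only: DB_stabilise)
  next
    case (stabilise_Neg n w)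
    then show ?case by (simp only: DB_stabilise)
  qed simp_all
  then show ?thesis unfolding link_invariant_def by blast
qed

text \<open>An idle strand contributes the trace of \<nu>. This direct computation replaces a
  division by \<open>a * b' - a' * b\<close>.\<close>

lemma DB_split_unknot:
  assumes w: "braid_word n w"
  shows "F (Suc n) w = v' * \<delta> * F n w"
proof -
  note W = rep_carrier[OF w] and V = nu_pow_carrier[of n]
  have "N (Suc n) * braid_rep R (Suc n) w = (N n * braid_rep R n w) \<otimes>\<^sub>t \<nu>"
    using tensor_pow_add[of \<nu> n 1] w V W carriers(4)
    by (auto simp: braid_rep_Suc[OF R_carriers] tensor_mat_mult)
  then have "mat_tr (N (Suc n) * braid_rep R (Suc n) w) = mat_tr (N n * braid_rep R n w) * \<delta>"
    using mat_tr_tensor[OF mult_carrier_mat[OF V W] carriers(4)] by (simp add: nu_trace)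
  moreover have "unit_power v (- int (Suc n)) = unit_power v (- int n) * v'"
    using v_power[of "- int n" "- 1"] by (simp add: ac_simps)
  ultimately show ?thesis by (simp add: DB_def ac_simps)
qed

text \<open>In \<open>b'\<close> times \<open>R\<close> minus \<open>b\<close> times its inverse the
  \<open>U\<close> terms cancel, leaving a multiple of the identity; the powers of \<open>u\<close>
  absorb the change of writhe.\<close>

lemma DB_skein: "skein_relation (b' * u) (b * u') (a * b' - a' * b) F"
  unfolding skein_relation_def
proof (intro allI impI)
  fix n p q i assume bw: "braid_word n (p @ [Pos i] @ q)"
  then have p: "braid_word n p" and q: "braid_word n q" and i: "Suc i < n" by simp_all
  define k where "k = n - 2 - i"
  have ik: "i + 2 + k = n" using i by (simp add: k_def)
  \<comment> \<open>Only the crossing varies: all three closures are combinations of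
    \<open>T\<close> at the identity and at \<open>U\<close>.\<close>
  define T where "T M = mat_tr (N n * (braid_rep R n p * (M * braid_rep R n q)))" for M
  note P = rep_carrier[OF p] and Q = rep_carrier[OF q] and V = nu_pow_carrier[of n]
  have I: "strand_mat i k (1\<^sub>m 4) = 1\<^sub>m (2 ^ n)" using strand_mat_one[of i k 2] by (simp only: ik four_eq)
  let ?E = "strand_mat i k U"
  have E: "?E \<in> carrier_mat (2 ^ n) (2 ^ n)" using strand_mat_carrier[of U 2 i k] carriers(3) by (simp only: ik four_eq)
  have T_R: "T (strand_mat i k (R_mat x y \<beta> \<gamma>)) = x * T (1\<^sub>m (2 ^ n)) + y * T ?E" for x y
  proof -
    have "strand_mat i k (R_mat x y \<beta> \<gamma>) = x \<cdot>\<^sub>m 1\<^sub>m (2 ^ n) + y \<cdot>\<^sub>m ?E"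
      unfolding R_mat_def using carriers(3)
      by (simp add: strand_mat_linear[of _ 4] I)
    then have "N n * (braid_rep R n p * (strand_mat i k (R_mat x y \<beta> \<gamma>) * braid_rep R n q))
        = x \<cdot>\<^sub>m (N n * (braid_rep R n p * (1\<^sub>m (2 ^ n) * braid_rep R n q)))
          + y \<cdot>\<^sub>m (N n * (braid_rep R n p * (?E * braid_rep R n q)))"
      using P Q V E
      by (simp add: add_mult_distrib_mat[of _ "2 ^ n" "2 ^ n" _ _ "2 ^ n"]
        mult_add_distrib_mat[of _ "2 ^ n" "2 ^ n" _ "2 ^ n"]
        mult_smult_distrib[of _ "2 ^ n" "2 ^ n" _ "2 ^ n"] mult_smult_assoc_mat[of _ "2 ^ n" "2 ^ n" _ "2 ^ n"]
        mult_carrier_mat[of _ "2 ^ n" "2 ^ n" _ "2 ^ n"])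
    then show ?thesis unfolding T_def using P Q V E
      by (simp add: mat_tr_linear[of _ "2 ^ n"] mult_carrier_mat[of _ "2 ^ n" "2 ^ n" _ "2 ^ n"])
  qed
  let ?c = "unit_power u (- writhe (p @ q)) * unit_power v (- int n)"
  have pos: "- writhe (p @ [Pos i] @ q) = - 1 + - writhe (p @ q)"
    and neg: "- writhe (p @ [Neg i] @ q) = 1 + - writhe (p @ q)" by simp_all
  have "F n (p @ [Pos i] @ q) = u' * ?c * (a * T (1\<^sub>m (2 ^ n)) + b * T ?E)"
    unfolding DB_def pos u_power using p q i T_R[of a b]
    by (simp add: rep_append rep_Cons T_def crossing_mat_Pos_Neg[OF ik] ac_simps del: writhe_append)
  moreover have "F n (p @ [Neg i] @ q) = u * ?c * (a' * T (1\<^sub>m (2 ^ n)) + b' * T ?E)"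
    unfolding DB_def neg u_power using p q i T_R[of a' b']
    by (simp add: rep_append rep_Cons T_def crossing_mat_Pos_Neg[OF ik] R_inverse ac_simps del: writhe_append)
  moreover have "F n (p @ q) = ?c * T (1\<^sub>m (2 ^ n))"
    using p q Q by (simp add: DB_def rep_append T_def del: writhe_append)
  ultimately have "b' * u * F n (p @ [Pos i] @ q) - b * u' * F n (p @ [Neg i] @ q)
      = (u * u') * ((a * b' - a' * b) * F n (p @ q))"
    by (simp only:) (simp add: algebra_simps del: writhe_append)
  then show "b' * u * F n (p @ [Pos i] @ q) - b * u' * F n (p @ [Neg i] @ q)
      = (a * b' - a' * b) * F n (p @ q)"
    by (simp only: inverses mult_1)
qed

end


section \<open>Square roots of one in the truncated polynomial ring\<close>

text \<open>The constant term squares to one in a domain, so it is a sign; the coefficient of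
  \<open>t\<close> then satisfies \<open>2 * (coeff p 0 * coeff p 1) = 0\<close> and
  vanishes.\<close>

lemma trunc_square_one:
  fixes \<epsilon> :: "'a::comm_ring_1 trunc"
  assumes sq: "\<epsilon>^2 = 1" and domain: "\<And>x y :: 'a. x * y = 0 \<Longrightarrow> x = 0 \<or> y = 0"
    and two: "(2 :: 'a) \<noteq> 0"
  shows "\<epsilon> = 1 \<or> \<epsilon> = - 1"
  using sq unfolding power2_eq_square
proof transfer
  fix p :: "'a poly" assume "trunc_rel (p * p) 1"
  then have coeffs: "coeff (p * p - 1) k = 0" if "k < 2" for k
    using that by (simp add: trunc_rel_def monom_1_dvd_iff')
  have "coeff p 0 * coeff p 0 = 1" using coeffs[of 0] by (simp add: coeff_mult)
  then have "(coeff p 0 - 1) * (coeff p 0 + 1) = 0" by (simp add: algebra_simps)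
  then have c0: "coeff p 0 = 1 \<or> coeff p 0 = - 1" using domain by (metis add_eq_0_iff2 eq_iff_diff_eq_0)
  have "2 * (coeff p 0 * coeff p 1) = 0" using coeffs[of 1] by (simp add: coeff_mult algebra_simps)
  then have "coeff p 0 * coeff p 1 = 0" using domain two by blast
  then have c1: "coeff p 1 = 0" using c0 by auto
  have "trunc_rel p 1 \<longleftrightarrow> coeff p 0 = 1" "trunc_rel p (- 1) \<longleftrightarrow> coeff p 0 = - 1"
    using c1 by (auto simp: trunc_rel_def monom_1_dvd_iff' less_two_cases add_eq_0_iff2)
  then show "trunc_rel p 1 \<or> trunc_rel p (- 1)" using c0 by blast
qed


section \<open>Evaluation of Laurent polynomials\<close>

lemma laurent_eval_superset:
  assumes "finite K" "Poly_Mapping.keys f \<subseteq> K"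
  shows "laurent_eval s f = (\<Sum>k\<in>K. of_int (Poly_Mapping.lookup f k) * unit_power s k)"
  unfolding laurent_eval_def using assms
  by (intro sum.mono_neutral_left) (auto simp: in_keys_iff)

lemma laurent_eval_add: "laurent_eval s (f + g) = laurent_eval s f + laurent_eval s g"
proof -
  let ?K = "Poly_Mapping.keys f \<union> Poly_Mapping.keys g"
  have "laurent_eval s (f + g) = (\<Sum>k\<in>?K. of_int (Poly_Mapping.lookup (f + g) k) * unit_power s k)"
    using keys_add[of f g] by (intro laurent_eval_superset) auto
  also have "\<dots> = laurent_eval s f + laurent_eval s g"
    by (simp add: laurent_eval_superset[of ?K f] laurent_eval_superset[of ?K g] lookup_add algebra_simps sum.distrib)
  finally show ?thesis .
qed

lemma laurent_eval_zero [simp]: "laurent_eval s 0 = 0"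
  by (simp add: laurent_eval_def)

lemma laurent_eval_diff: "laurent_eval s (f - g) = laurent_eval s f - laurent_eval s g"
  using laurent_eval_add[of s "f - g" g] by (simp add: algebra_simps)

lemma laurent_eval_single: "laurent_eval s (Poly_Mapping.single k x) = of_int x * unit_power s k"
  by (simp add: laurent_eval_superset[of "{k}"])

text \<open>Every skein coefficient is a monomial or a difference of two, so this case of
  multiplicativity carries the skein relation through evaluation.\<close>

lemma laurent_eval_shift:
  assumes "s dvd 1"
  shows "laurent_eval s (s_pow k * f) = unit_power s k * laurent_eval s f"
proof (induction f rule: update_induct)
  case const
  then show ?case by simp
next
  case (update f j x)
  have "Poly_Mapping.update j x f = Poly_Mapping.single j x + f"
    using update(1) by (intro poly_mapping_eqI) (auto simp: lookup_update lookup_add lookup_single in_keys_iff when_def)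
  then show ?case
    using update unit_power_add[OF assms, of k j]
    by (simp add: distrib_left laurent_eval_add mult_single laurent_eval_single ac_simps)
qed

lemma laurent_eval_one: "laurent_eval s 1 = 1"
  using laurent_eval_single[of s 0 1] by simp

lemma s_pow_mult: "s_pow j * s_pow k = s_pow (j + k)"
  by (simp add: mult_single)

text \<open>Insert a crossing joining the last two strands: both signs are stabilisations of
  \<open>w\<close>, and the smoothing is \<open>w\<close> with a split unknot. The common factor may
  be cancelled because integer Laurent polynomials form a domain.\<close>

lemma jones_split_unknot:
  assumes "is_jones_polynomial J" "braid_word n w"
  shows "J (Suc n) w = - (s_pow 1 + s_pow (- 1)) * J n w"
proof -
  have inv: "link_invariant J" and skein: "skein_relation (s_pow (- 2)) (s_pow 2) (s_pow 1 - s_pow (- 1)) J"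
    using assms(1) by (simp_all add: is_jones_polynomial_def)
  have n: "braid_word (Suc n) (w @ [Pos (n - 1)] @ [])"
    using assms(2) by (auto simp: braid_word_def)
  have "(s_pow 1 - s_pow (- 1)) * J (Suc n) w = (s_pow (- 2) - s_pow 2) * J n w"
    using skein_relationD[OF skein n] link_invariantD[OF inv stabilise_Pos[OF assms(2)]]
      link_invariantD[OF inv stabilise_Neg[OF assms(2)]]
    by (simp add: algebra_simps)
  also have "s_pow (- 2) - s_pow 2 = (s_pow 1 - s_pow (- 1)) * - (s_pow 1 + s_pow (- 1))"
    by (simp add: algebra_simps s_pow_mult)
  finally have "(s_pow 1 - s_pow (- 1)) * J (Suc n) w = (s_pow 1 - s_pow (- 1)) * (- (s_pow 1 + s_pow (- 1)) * J n w)"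
    by (simp only: mult.assoc)
  moreover have "s_pow 1 - s_pow (- 1) \<noteq> 0"
  proof
    assume "s_pow 1 - s_pow (- 1) = 0"
    then have "Poly_Mapping.lookup (s_pow 1) 1 = Poly_Mapping.lookup (s_pow (- 1)) 1" by simp
    then show False by (simp add: lookup_single)
  qed
  ultimately show ?thesis by (simp only: mult_cancel_left) simp
qed

text \<open>
  Both sides satisfy the skein relation with the same coefficients and multiply by the same
  factor \<open>\<kappa>\<close> under adding a split unknot, so \<open>skein_invariant_vanishes\<close> applies to their
  difference.
\<close>

lemma skein_invariant_eq_jones:
  fixes F :: "nat \<Rightarrow> crossing list \<Rightarrow> 'a::comm_ring_1"
  assumes inv: "link_invariant F" and skein: "skein_relation l l' z F"
    and l: "l dvd 1" "l' dvd 1"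
    and split: "\<And>n w. braid_word n w \<Longrightarrow> F (Suc n) w = \<kappa> * F n w"
    and s: "s dvd 1"
    and coeffs: "l = \<epsilon> * unit_power s (- 2)" "l' = \<epsilon> * unit_power s 2" "z = \<epsilon> * (s - ring_inv s)"
    and \<kappa>: "\<kappa> = - (s + ring_inv s)"
    and J: "is_jones_polynomial J" and w: "braid_word n w"
  shows "F n w = F 1 [] * laurent_eval s (J n w)"
proof -
  have invJ: "link_invariant J" and J1: "J 1 [] = 1"
    and skeinJ: "skein_relation (s_pow (- 2)) (s_pow 2) (s_pow 1 - s_pow (- 1)) J"
    using J by (simp_all add: is_jones_polynomial_def)
  define G where "G n w = laurent_eval s (J n w)" for n w
  define D where "D n w = F n w - F 1 [] * G n w" for n w
  have "D n w = 0"
  proof (rule skein_invariant_vanishes[of D l l' z \<kappa>])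
    show "link_invariant D"
      using inv invJ unfolding link_invariant_def D_def G_def by metis
    show "skein_relation l l' z D"
      unfolding skein_relation_def
    proof (intro allI impI)
      fix n p q i assume bw: "braid_word n (p @ [Pos i] @ q)"
      let ?P = "p @ [Pos i] @ q" and ?M = "p @ [Neg i] @ q" and ?O = "p @ q"
      have "laurent_eval s (s_pow (- 2) * J n ?P - s_pow 2 * J n ?M) = laurent_eval s (s_pow 1 * J n ?O - s_pow (- 1) * J n ?O)"
        using skein_relationD[OF skeinJ bw] by (simp only: left_diff_distrib)
      then have "unit_power s (- 2) * G n ?P - unit_power s 2 * G n ?M = (s - ring_inv s) * G n ?O"
        unfolding laurent_eval_diff laurent_eval_shift[OF s] unit_power_one G_def left_diff_distrib .
      then have "\<epsilon> * (unit_power s (- 2) * G n ?P - unit_power s 2 * G n ?M) = \<epsilon> * ((s - ring_inv s) * G n ?O)" by simp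
      then have G: "l * G n ?P - l' * G n ?M = z * G n ?O"
        unfolding coeffs by (simp only: right_diff_distrib[of \<epsilon> "_ * _"] mult.assoc)
      have "l * D n ?P - l' * D n ?M = (l * F n ?P - l' * F n ?M) - F 1 [] * (l * G n ?P - l' * G n ?M)"
        unfolding D_def by (simp only: algebra_simps)
      also have "\<dots> = z * F n ?O - F 1 [] * (z * G n ?O)"
        by (simp only: G skein_relationD[OF skein bw])
      also have "\<dots> = z * D n ?O"
        unfolding D_def by (simp only: algebra_simps)
      finally show "l * D n ?P - l' * D n ?M = z * D n ?O" .
    qed
    show "D (Suc n) w = \<kappa> * D n w" if "braid_word n w" for n w
    proof -
      have "G (Suc n) w = - (laurent_eval s (s_pow 1 * J n w) + laurent_eval s (s_pow (- 1) * J n w))"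
        unfolding G_def jones_split_unknot[OF J that]
        using laurent_eval_diff[of s 0 "s_pow 1 * J n w + s_pow (- 1) * J n w"]
        by (simp add: laurent_eval_add left_diff_distrib)
      also have "\<dots> = \<kappa> * G n w"
        by (simp only: laurent_eval_shift[OF s] unit_power_one \<kappa> G_def) (simp add: algebra_simps)
      finally show ?thesis unfolding D_def split[OF that] by (simp add: algebra_simps)
    qed
    show "D 1 [] = 0" unfolding D_def G_def J1 laurent_eval_one by simp
  qed (fact l w)+
  then show ?thesis by (simp add: D_def G_def)
qed

section \<open>Matching the parameters with those of the Jones polynomial\<close>

context enhanced_pair
begin

abbreviation "c \<equiv> a * b'"
abbreviation "\<epsilon> \<equiv> u * b * a'^2"

lemma c_inverse: "c * (a' * b) = 1" "ring_inv c = a' * b"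
proof -
  have "c * (a' * b) = (a * a') * (b * b')" by (simp only: ac_simps)
  then show "c * (a' * b) = 1" by (simp add: inverses)
  then show "ring_inv c = a' * b" by (rule ring_inv_unique)
qed

lemma loop_value_eq: "\<delta> = - (c + a' * b)"
proof -
  have "a' * b' * (a^2 + b^2 + \<delta> * a * b) = (a * a') * c + (b * b') * (a' * b) + \<delta> * (a * a') * (b * b')"
    by (simp add: power2_eq_square algebra_simps)
  then have "c + a' * b + \<delta> = 0" using rel by (simp add: inverses)
  then have "\<delta> + (c + a' * b) = 0" by (simp only: add.commute)
  then show ?thesis by (simp only: eq_neg_iff_add_eq_0)
qed

text \<open>Substituting the loop value cancels the summands \<open>b\<close> and \<open>b'\<close>,
  so both of Turaev's scalars become monomials.\<close>

lemma uv_eq: "u * v = - (a^2 * b')" "u' * v = - (a'^2 * b)"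
proof -
  have "\<delta> * a + b = - (a^2 * b') - (a * a') * b + b"
    by (simp add: loop_value_eq power2_eq_square algebra_simps)
  then show "u * v = - (a^2 * b')" using uv by (simp add: inverses)
  have "\<delta> * a' + b' = - ((a * a') * b') - a'^2 * b + b'"
    by (simp add: loop_value_eq power2_eq_square algebra_simps)
  then show "u' * v = - (a'^2 * b)" using uv' by (simp add: inverses)
qed

text \<open>Multiplying \<open>u' * v\<close> by \<open>u^2\<close> must give \<open>u * v\<close>;
  this eliminates \<open>v\<close> between the two equations.\<close>

lemma epsilon_squared: "\<epsilon>^2 = 1"
proof -
  have "u^2 * (u' * v) = (u * u') * (u * v)" by (simp add: power2_eq_square ac_simps)
  then have "u^2 * (a'^2 * b) = a^2 * b'" by (simp add: inverses uv_eq)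
  then have "(u^2 * (a'^2 * b)) * (b * a'^2) = (a^2 * b') * (b * a'^2)" by simp
  also have "\<dots> = (a * a')^2 * (b * b')" by (simp only: power2_eq_square ac_simps)
  also have "(u^2 * (a'^2 * b)) * (b * a'^2) = \<epsilon>^2" by (simp only: power2_eq_square ac_simps)
  finally show ?thesis by (simp add: inverses)
qed

lemma l_eq: "b' * u = \<epsilon> * c^2"
proof -
  have "\<epsilon> * c^2 = (a * a')^2 * (b * b') * (b' * u)" by (simp only: power2_eq_square ac_simps)
  then show ?thesis by (simp add: inverses)
qed

lemma l_inverse: "(b' * u) * (b * u') = 1" "ring_inv (b' * u) = b * u'"
proof -
  have "(b' * u) * (b * u') = (b * b') * (u * u')" by (simp only: ac_simps)
  then show "(b' * u) * (b * u') = 1" by (simp add: inverses)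
  then show "ring_inv (b' * u) = b * u'" by (rule ring_inv_unique)
qed

lemma v_inverse: "v' = - \<epsilon>"
proof (rule ring_inv_unique)
  have "v * - \<epsilon> = - (u * v) * (b * a'^2)" by (simp add: ac_simps)
  also have "\<dots> = (a * a')^2 * (b * b')" unfolding uv_eq minus_minus by (simp only: power2_eq_square ac_simps)
  finally show "v * - \<epsilon> = 1" by (simp add: inverses)
qed

lemma DB_eq_jones:
  assumes J: "is_jones_polynomial J" and w: "braid_word n w"
  shows "F n w = F 1 [] * laurent_eval (- \<epsilon> * ring_inv c) (J n w)"
proof -
  \<comment> \<open>The point is chosen to satisfy three conditions at once: \<open>?s\<close> to
    the power -2 is \<open>c^2\<close>, \<epsilon> times \<open>?s - ring_inv ?s\<close> is
    \<open>c - ring_inv c\<close>, and \<open>- (?s + ring_inv ?s)\<close> is the split-unknot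
    factor \<open>v' * \<delta>\<close>. The minus sign comes from the second.\<close>
  let ?s = "- \<epsilon> * (a' * b)"
  have "?s * (- \<epsilon> * c) = \<epsilon>^2 * (c * (a' * b))" by (simp only: power2_eq_square minus_mult_minus ac_simps)
  then have s: "?s * (- \<epsilon> * c) = 1" by (simp only: epsilon_squared c_inverse mult_1)
  then have unit: "?s dvd 1" and inv: "ring_inv ?s = - \<epsilon> * c"
    by (auto intro: dvdI ring_inv_unique simp del: mult_minus_left)
  have "F n w = F 1 [] * laurent_eval ?s (J n w)"
  proof (rule skein_invariant_eq_jones[OF link_invariant_DB DB_skein _ _ DB_split_unknot unit _ _ _ _ J w])
    show "b' * u dvd 1" "b * u' dvd 1" using l_inverse(1) by (metis dvd_triv_left dvd_triv_right)+
    have p2: "unit_power ?s (- 2) = c^2" "unit_power ?s 2 = (a' * b)^2"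
      using epsilon_squared by (simp_all add: unit_power_def inv power_mult_distrib del: mult_minus_left)
    show "b' * u = \<epsilon> * unit_power ?s (- 2)" by (simp only: p2 l_eq)
    have "b * u' = (\<epsilon> * \<epsilon>) * (c * (a' * b))^2 * (b * u')"
      using epsilon_squared by (simp add: c_inverse power2_eq_square)
    also have "\<dots> = \<epsilon> * (a' * b)^2 * ((\<epsilon> * c^2) * (b * u'))" by (simp only: power2_eq_square ac_simps)
    also have "\<dots> = \<epsilon> * (a' * b)^2" by (simp only: l_eq[symmetric] l_inverse mult_1_right)
    finally show "b * u' = \<epsilon> * unit_power ?s 2" by (simp only: p2)
    have "\<epsilon> * (?s - ring_inv ?s) = \<epsilon>^2 * (c - a' * b)"
      unfolding inv by (simp add: power2_eq_square algebra_simps)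
    then show "a * b' - a' * b = \<epsilon> * (?s - ring_inv ?s)" by (simp only: epsilon_squared mult_1)
    show "v' * \<delta> = - (?s + ring_inv ?s)"
      unfolding inv v_inverse loop_value_eq by (simp add: algebra_simps)
  qed
  then show ?thesis by (simp only: c_inverse)
qed

end

text \<open>The factor \<open>F 1 []\<close> appears because \<open>DB\<close> is not normalised:
  its unknot value is \<open>ring_inv v * \<delta>0\<close>, which need not be a unit. The domain
  condition sits inside the conclusion so that the evaluation also holds over rings where \<epsilon>
  is not a sign.\<close>

theorem proposition4p8:
  fixes \<iota> :: "complex \<Rightarrow> 'k::comm_ring_1"
    and A A' :: 'k
    and \<beta> \<gamma> \<beta>1 \<gamma>1 :: "'k mat"
    and \<beta>t \<gamma>t Rt \<nu> :: "'k trunc mat"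
    and a b c l \<delta>0 u v :: "'k trunc"
    and F :: "nat \<Rightarrow> crossing list \<Rightarrow> 'k trunc"
  assumes "comm_ring_hom \<iota>"
    and "A * A' = 1"
    and "\<beta> = kauffman_\<beta> (\<iota> \<i>) A A'"
    and "\<gamma> = kauffman_\<gamma> (\<iota> \<i>) A A'"
    and "switchback_2cocycle \<beta> \<gamma> \<beta>1 \<gamma>1"
    and "\<beta>t = deform \<beta> \<beta>1"
    and "\<gamma>t = deform \<gamma> \<gamma>1"
    and "\<delta>0 = loop_value \<beta>t \<gamma>t"
    and "a dvd 1" and "b dvd 1"
    and "a^2 + b^2 + \<delta>0 * a * b = 0"
    and "Rt = R_mat a b \<beta>t \<gamma>t"
    and "\<nu> = nu_mat \<beta>t \<gamma>t"
    and "u dvd 1" and "v dvd 1"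
    and "u * v = \<delta>0 * a + b"
    and "ring_inv u * v = \<delta>0 * ring_inv a + ring_inv b"
    and "c = a * ring_inv b"
    and "l = ring_inv b * u"
    and "F = DB Rt \<nu> u v"
  shows "link_invariant F
    \<and> skein_relation (ring_inv b * u) (b * ring_inv u) (a * ring_inv b - ring_inv a * b) F
    \<and> skein_relation l (ring_inv l) (c - ring_inv c) F
    \<and> (\<exists>\<epsilon>. \<epsilon>^2 = 1
         \<and> ((\<forall>x y :: 'k. x * y = 0 \<longrightarrow> x = 0 \<or> y = 0) \<longrightarrow> \<epsilon> = 1 \<or> \<epsilon> = - 1)
         \<and> l = \<epsilon> * c^2
         \<and> (\<forall>J. is_jones_polynomial J \<longrightarrow>
              (\<forall>n w. braid_word n w \<longrightarrow>
                 F n w = F 1 [] * laurent_eval (- \<epsilon> * ring_inv c) (J n w))))"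
proof -
  interpret \<iota>: comm_ring_hom \<iota> by fact
  have "\<iota> \<i> * \<iota> \<i> = \<iota> (- 1)" by (simp flip: \<iota>.hom_mult)
  then have im: "\<iota> \<i> * \<iota> \<i> = - 1" by (simp add: \<iota>.hom_uminus)
  \<comment> \<open>The image of the complex number 1/2 inverts 2, which rules out characteristic
    two in the sign argument.\<close>
  have "2 * \<iota> (1 / 2) = \<iota> (1 / 2 + 1 / 2)" by (simp only: \<iota>.hom_add mult_2)
  then have two: "(2 :: 'k) \<noteq> 0" by auto
  have pair: "switchback_pair \<beta>t \<gamma>t"
    using assms switchback_pair_deform switchback_pair_kauffman[OF im] by metis
  interpret enhanced_pair \<beta>t \<gamma>t a b u v
    using pair assms by unfold_locales simp_all
  have "ring_inv l = b * ring_inv u" "ring_inv c = ring_inv a * b" "l = u * b * (ring_inv a)^2 * c^2"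
    using l_inverse l_eq c_inverse assms by simp_all
  moreover have "u * b * (ring_inv a)^2 = 1 \<or> u * b * (ring_inv a)^2 = - 1"
    if "\<forall>x y :: 'k. x * y = 0 \<longrightarrow> x = 0 \<or> y = 0"
    using trunc_square_one[OF epsilon_squared _ two] that by blast
  moreover have "F = DB (R_mat a b \<beta>t \<gamma>t) (nu_mat \<beta>t \<gamma>t) u v" using assms by simp
  ultimately show ?thesis
    using link_invariant_DB DB_skein DB_eq_jones epsilon_squared assms(18,19)
    by (intro conjI exI[of _ "u * b * (ring_inv a)^2"]) simp_all
qed

end
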